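(* Let $n\ge1$, let $A$ be the pseudo-differential operator with symbol $\mathcal{A}\in\mathcal{E}(\mathbb{Q}_2^n\setminus\{0\})$, and let $e\subset\{1,\dots,n\}$, $e\ne\emptyset$, $j\in\mathbb{Z}$, $a\in I_2^n$. Then the function $$\Psi^{(0)}_{e;ja}(x)=2^{-nj/2}\chi_2\big(2^{-1}k_e\cdot(2^jx-a)\big)\,\Omega\big(|2^jx-a|_2\big),\qquad x\in\mathbb{Q}_2^n,$$ is an eigenfunction of $A$ if and only if $$\mathcal{A}\big(2^j(-2^{-1}k_e+\eta)\big)=\mathcal{A}\big(-2^{j-1}k_e\big)\qquad\text{for all }\eta\in\mathbb{Z}_2^n.$$ The corresponding eigenvalue is $\lambda=\mathcal{A}(-2^{j-1}k_e)$, i.e. $A\Psi^{(0)}_{e;ja}=\mathcal{A}(-2^{j-1}k_e)\Psi^{(0)}_{e;ja}$.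
   Context: $\mathbb{Q}_2$ is the field of $2$-adic numbers; on $\mathbb{Q}_2^n$ use the norm $|x|_2=\max_\nu|x_\nu|_2$ and the product Haar measure $d^nx$ normalized so that $\mathbb{Z}_2^n$ has measure $1$. $\chi_2(t)=e^{2\pi i\{t\}_2}$, $t\in\mathbb{Q}_2$, with $\{t\}_2$ the $2$-adic fractional part; $\xi\cdot x=\sum_\nu\xi_\nu x_\nu$. $\Omega(t)=1$ for $0\le t\le1$, $\Omega(t)=0$ for $t>1$. $I_2=\{2^{-\gamma}(a_0+a_12+\cdots+a_{\gamma-1}2^{\gamma-1}):\gamma\in\mathbb{N},\ a_j\in\{0,1\}\}\subset\mathbb{Q}_2$, $I_2^n=I_2\times\cdots\times I_2$. For $e\subset\{1,\dots,n\}$, $k_e\in\{0,1\}^n$ has $(k_e)_\nu=1$ if $\nu\in e$ and $0$ otherwise. $\mathcal{D}(\mathbb{Q}_2^n)$ is the space of locally constant compactly supported functions $\mathbb{Q}_2^n\to\mathbb{C}$; $\mathcal{E}(\mathbb{Q}_2^n\setminus\{0\})$ is the space of locally constant functions $\mathbb{Q}_2^n\setminus\{0\}\to\mathbb{C}$. Fourier transform: $F[\varphi](\xi)=\int_{\mathbb{Q}_2^n}\chi_2(\xi\cdot x)\varphi(x)\,d^nx$, with inverse $F^{-1}[\varphi](x)=\int_{\mathbb{Q}_2^n}\chi_2(-x\cdot\xi)\varphi(\xi)\,d^n\xi$. The Lizorkin space is $\Phi(\mathbb{Q}_2^n)=\{\phi\in\mathcal{D}(\mathbb{Q}_2^n):\int\phi\,d^nx=0\}$,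 equivalently those $\phi\in\mathcal{D}(\mathbb{Q}_2^n)$ with $F[\phi](0)=0$; each $\Psi^{(0)}_{e;ja}$ belongs to it. The pseudo-differential operator $A$ with symbol $\mathcal{A}$ is $A\phi=F^{-1}\big[\mathcal{A}\,F[\phi]\big]$ for $\phi\in\Phi(\mathbb{Q}_2^n)$ (here $F[\phi]$ vanishes near $0$, and $\mathcal{A}F[\phi]$ is taken to be $0$ at $0$). An eigenfunction is a nonzero $f$ with $Af=\lambda f$ for some $\lambda\in\mathbb{C}$. *)

theory Defs
  imports "HOL-Analysis.Analysis" "HOL-Computational_Algebra.Primes" "HOL-Number_Theory.Cong"
begin

text \<open>The 2-adic absolute value on the rationals, normalized by $|2| = 1/2$.\<close>

definition rat_norm2 :: "rat \<Rightarrow> real" where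
  "rat_norm2 q = (if q = 0 then 0 else
     2 powi (int (multiplicity 2 (snd (quotient_of q))) - int (multiplicity 2 (fst (quotient_of q)))))"

lemma prime_elem_2_int: "prime_elem (2::int)"
  by (rule prime_imp_prime_elem) simp

lemma rat_norm2_0 [simp]: "rat_norm2 0 = 0"
  by (simp add: rat_norm2_def)

lemma rat_norm2_divide:
  assumes "a \<noteq> 0" "b \<noteq> 0"
  shows "rat_norm2 (of_int a / of_int b) = 2 powi (int (multiplicity 2 b) - int (multiplicity 2 a))"
proof -
  obtain c d where cd: "quotient_of (of_int a / of_int b) = (c, d)"
    by (cases "quotient_of (of_int a / of_int b)") auto
  have d: "d > 0" using quotient_of_denom_pos[OF cd] .
  have q: "(of_int a / of_int b :: rat) = of_int c / of_int d"
    using quotient_of_div[OF cd] .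
  have c: "c \<noteq> 0" using q assms d by auto
  have "(of_int (a * d) :: rat) = of_int (c * b)"
    using q assms d by (simp add: field_simps)
  then have "a * d = c * b" by (simp only: of_int_eq_iff)
  then have "multiplicity 2 a + multiplicity 2 d = multiplicity 2 c + multiplicity 2 b"
    using prime_elem_multiplicity_mult_distrib[OF prime_elem_2_int] assms c d
    by (metis less_int_code(1))
  then have "int (multiplicity 2 d) - int (multiplicity 2 c) = int (multiplicity 2 b) - int (multiplicity 2 a)"
    by linarith
  then show ?thesis
    using assms cd by (simp add: rat_norm2_def)
qed

lemma rat_norm2_of_int:
  "a \<noteq> 0 \<Longrightarrow> rat_norm2 (of_int a) = 2 powi (- int (multiplicity 2 a))"
  using rat_norm2_divide[of a 1] by simp

lemma rat_quot:
  fixes q :: rat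
  obtains a b :: int where "b \<noteq> 0" "q = of_int a / of_int b"
proof -
  obtain a b where ab: "quotient_of q = (a, b)" by (cases "quotient_of q")
  show ?thesis
    by (rule that[of b a]) (use quotient_of_denom_pos[OF ab] quotient_of_div[OF ab] in auto)
qed

lemma rat_norm2_mult: "rat_norm2 (x * y) = rat_norm2 x * rat_norm2 y"
proof (cases "x = 0 \<or> y = 0")
  case False
  obtain a b where ab: "b \<noteq> 0" "x = of_int a / of_int b" by (rule rat_quot)
  obtain c d where cd: "d \<noteq> 0" "y = of_int c / of_int d" by (rule rat_quot)
  have nz: "a \<noteq> 0" "c \<noteq> 0" using False ab cd by auto
  have "x * y = of_int (a * c) / of_int (b * d)" using ab cd by simp
  then have "rat_norm2 (x * y) = 2 powi (int (multiplicity 2 (b * d)) - int (multiplicity 2 (a * c)))"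
    using rat_norm2_divide[of "a * c" "b * d"] nz ab cd by simp
  also have "\<dots> = 2 powi ((int (multiplicity 2 b) - int (multiplicity 2 a)) + (int (multiplicity 2 d) - int (multiplicity 2 c)))"
    using nz ab cd by (intro arg_cong2[where f = power_int] refl) (simp add: prime_elem_multiplicity_mult_distrib[OF prime_elem_2_int])
  also have "\<dots> = rat_norm2 x * rat_norm2 y"
    using rat_norm2_divide nz ab cd by (simp add: power_int_add)
  finally show ?thesis .
qed auto

lemma rat_norm2_nonneg [simp]: "rat_norm2 x \<ge> 0"
  by (simp add: rat_norm2_def)

lemma rat_norm2_eq_0 [simp]: "rat_norm2 x = 0 \<longleftrightarrow> x = 0"
  by (simp add: rat_norm2_def)

lemma rat_norm2_1 [simp]: "rat_norm2 1 = 1"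
  by (simp add: rat_norm2_def)

lemma rat_norm2_inverse: "rat_norm2 (inverse x) = inverse (rat_norm2 x)"
proof (cases "x = 0")
  case False
  then have "rat_norm2 (inverse x) * rat_norm2 x = 1"
    by (simp flip: rat_norm2_mult)
  then show ?thesis using False by (simp add: field_simps)
qed auto

lemma rat_norm2_minus [simp]: "rat_norm2 (- x) = rat_norm2 x"
proof -
  have "rat_norm2 (-1) = 1"
    using rat_norm2_of_int[of "-1"] by (simp add: multiplicity_unit_right)
  then show ?thesis using rat_norm2_mult[of "-1" x] by simp
qed

lemma rat_norm2_minus_commute: "rat_norm2 (x - y) = rat_norm2 (y - x)"
  by (metis minus_diff_eq rat_norm2_minus)

lemma rat_norm2_int_le:
  "rat_norm2 (of_int a) \<le> 2 powi (- int k) \<longleftrightarrow> 2 ^ k dvd a"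
proof (cases "a = 0")
  case False
  have "2 ^ k dvd a \<longleftrightarrow> k \<le> multiplicity 2 a"
    using False by (intro power_dvd_iff_le_multiplicity) auto
  moreover have "rat_norm2 (of_int a) = 2 powi (- int (multiplicity 2 a))"
    using False by (rule rat_norm2_of_int)
  moreover have "(2::real) powi (- int (multiplicity 2 a)) \<le> 2 powi (- int k) \<longleftrightarrow> - int (multiplicity 2 a) \<le> - int k"
    using power_int_increasing[of "- int (multiplicity 2 a)" "- int k" "2::real"]
      power_int_strict_increasing[of "- int k" "- int (multiplicity 2 a)" "2::real"]
    by (metis not_le one_le_numeral one_less_numeral_iff semiring_norm(76))
  ultimately show ?thesis by simp
qed auto

lemma rat_norm2_ultra: "rat_norm2 (x + y) \<le> max (rat_norm2 x) (rat_norm2 y)"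
proof -
  obtain a b where ab: "b \<noteq> 0" "x = of_int a / of_int b" by (rule rat_quot)
  obtain c d where cd: "d \<noteq> 0" "y = of_int c / of_int d" by (rule rat_quot)
  define u v where "u = a * d" and "v = c * b"
  define w where "w = rat_norm2 (inverse (of_int (b * d)))"
  have x: "x = of_int u * inverse (of_int (b * d))" and y: "y = of_int v * inverse (of_int (b * d))"
    using ab cd by (auto simp: u_def v_def field_simps)
  have xy: "x + y = of_int (u + v) * inverse (of_int (b * d))"
    using x y by (simp add: algebra_simps)
  have *: "rat_norm2 (of_int (u + v)) \<le> max (rat_norm2 (of_int u)) (rat_norm2 (of_int v))"
  proof (cases "u = 0 \<or> v = 0")
    case False
    define k where "k = min (multiplicity 2 u) (multiplicity 2 v)"
    have "2 ^ k dvd u" "2 ^ k dvd v"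
      by (auto simp: k_def intro: multiplicity_dvd')
    then have "2 ^ k dvd u + v" by simp
    then have "rat_norm2 (of_int (u + v)) \<le> 2 powi (- int k)"
      by (simp only: rat_norm2_int_le)
    also have "\<dots> \<le> max (rat_norm2 (of_int u)) (rat_norm2 (of_int v))"
      using False by (auto simp: rat_norm2_of_int k_def min_def le_max_iff_disj)
    finally show ?thesis .
  qed auto
  have "rat_norm2 (x + y) = rat_norm2 (of_int (u + v)) * w"
    unfolding xy w_def by (rule rat_norm2_mult)
  also have "\<dots> \<le> max (rat_norm2 (of_int u)) (rat_norm2 (of_int v)) * w"
    using * by (intro mult_right_mono) (auto simp: w_def)
  also have "\<dots> = max (rat_norm2 x) (rat_norm2 y)"
    unfolding x y rat_norm2_mult w_def[symmetric] by (simp add: max_mult_distrib_right w_def)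
  finally show ?thesis .
qed

lemma rat_norm2_triangle: "rat_norm2 (x + y) \<le> rat_norm2 x + rat_norm2 y"
  using rat_norm2_ultra[of x y] rat_norm2_nonneg[of x] rat_norm2_nonneg[of y] by linarith

lemma rat_norm2_diff_triangle: "\<bar>rat_norm2 x - rat_norm2 y\<bar> \<le> rat_norm2 (x - y)"
  using rat_norm2_triangle[of "x - y" y] rat_norm2_triangle[of "y - x" x]
  by (simp add: rat_norm2_minus_commute[of y x])

definition cauchy2 :: "(nat \<Rightarrow> rat) \<Rightarrow> bool" where
  "cauchy2 X \<longleftrightarrow> (\<forall>e>0. \<exists>k. \<forall>m\<ge>k. \<forall>n\<ge>k. rat_norm2 (X m - X n) < e)"

definition null2 :: "(nat \<Rightarrow> rat) \<Rightarrow> bool" where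
  "null2 X \<longleftrightarrow> (\<lambda>n. rat_norm2 (X n)) \<longlonglongrightarrow> 0"

lemma null2_cmp:
  assumes "f \<longlonglongrightarrow> 0" "\<And>n. rat_norm2 (X n) \<le> f n"
  shows "null2 X"
  unfolding null2_def
  by (rule tendsto_sandwich[OF _ _ tendsto_const assms(1)]) (simp_all add: assms(2))

lemma null2_add: "null2 X \<Longrightarrow> null2 Y \<Longrightarrow> null2 (\<lambda>n. X n + Y n)"
  by (rule null2_cmp[where f = "\<lambda>n. rat_norm2 (X n) + rat_norm2 (Y n)"])
     (auto simp: null2_def rat_norm2_triangle intro: tendsto_add_zero)

lemma null2_minus: "null2 X \<Longrightarrow> null2 (\<lambda>n. - X n)"
  by (simp add: null2_def)

lemma null2_diff: "null2 X \<Longrightarrow> null2 Y \<Longrightarrow> null2 (\<lambda>n. X n - Y n)"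
  using null2_add[OF _ null2_minus, of X Y] by simp

lemma null2_mult:
  assumes "null2 X" "\<And>n. rat_norm2 (Y n) \<le> B"
  shows "null2 (\<lambda>n. X n * Y n)"
proof (rule null2_cmp[where f = "\<lambda>n. rat_norm2 (X n) * B"])
  show "(\<lambda>n. rat_norm2 (X n) * B) \<longlonglongrightarrow> 0"
    using assms(1) unfolding null2_def by (rule tendsto_mult_left_zero)
qed (auto simp: rat_norm2_mult assms(2) intro!: mult_left_mono)

lemma cauchy2_const [simp]: "cauchy2 (\<lambda>_. c)"
  by (simp add: cauchy2_def)

lemma cauchy2_norm_convergent:
  assumes "cauchy2 X"
  shows "convergent (\<lambda>n. rat_norm2 (X n))"
proof (rule Cauchy_convergent, rule metric_CauchyI)
  fix e :: real assume "e > 0"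
  then obtain k where "\<forall>m\<ge>k. \<forall>n\<ge>k. rat_norm2 (X m - X n) < e"
    using assms unfolding cauchy2_def by blast
  then show "\<exists>M. \<forall>m\<ge>M. \<forall>n\<ge>M. dist (rat_norm2 (X m)) (rat_norm2 (X n)) < e"
    unfolding dist_real_def using rat_norm2_diff_triangle by (meson le_less_trans)
qed

lemma cauchy2_bounded: "cauchy2 X \<Longrightarrow> \<exists>B. \<forall>n. rat_norm2 (X n) \<le> B"
  using convergent_imp_Bseq[OF cauchy2_norm_convergent] by (auto simp: Bseq_def)

lemma cauchy2_by:
  assumes "\<And>e. e > 0 \<Longrightarrow> \<exists>d>0. \<forall>m n. f m n < d \<longrightarrow> g m n < d \<longrightarrow> rat_norm2 (Z m - Z n) < e"
    and "\<And>d. d > 0 \<Longrightarrow> \<exists>k. \<forall>m\<ge>k. \<forall>n\<ge>k. f m n < d"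
    and "\<And>d. d > 0 \<Longrightarrow> \<exists>k. \<forall>m\<ge>k. \<forall>n\<ge>k. g m n < (d::real)"
  shows "cauchy2 Z"
  unfolding cauchy2_def
proof (intro allI impI)
  fix e :: real assume "e > 0"
  from assms(1)[OF this] obtain d where
    d: "d > 0" "\<And>m n. f m n < d \<Longrightarrow> g m n < d \<Longrightarrow> rat_norm2 (Z m - Z n) < e"
    by metis
  obtain k where k: "\<And>m n. m \<ge> k \<Longrightarrow> n \<ge> k \<Longrightarrow> f m n < d" using assms(2)[OF d(1)] by metis
  obtain l where l: "\<And>m n. m \<ge> l \<Longrightarrow> n \<ge> l \<Longrightarrow> g m n < d" using assms(3)[OF d(1)] by metis
  show "\<exists>k. \<forall>m\<ge>k. \<forall>n\<ge>k. rat_norm2 (Z m - Z n) < e"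
    by (intro exI[of _ "max k l"] allI impI d(2) k l) auto
qed

lemma cauchy2_add:
  assumes "cauchy2 X" "cauchy2 Y"
  shows "cauchy2 (\<lambda>n. X n + Y n)"
proof (rule cauchy2_by[where f = "\<lambda>m n. rat_norm2 (X m - X n)" and g = "\<lambda>m n. rat_norm2 (Y m - Y n)"])
  fix e :: real assume "e > 0"
  then show "\<exists>d>0. \<forall>m n. rat_norm2 (X m - X n) < d \<longrightarrow> rat_norm2 (Y m - Y n) < d \<longrightarrow>
      rat_norm2 (X m + Y m - (X n + Y n)) < e"
    unfolding add_diff_add
    by (intro exI[of _ e] conjI allI impI le_less_trans[OF rat_norm2_ultra]) auto
qed (use assms in \<open>auto simp: cauchy2_def\<close>)

lemma cauchy2_minus: "cauchy2 X \<Longrightarrow> cauchy2 (\<lambda>n. - X n)"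
  by (simp add: cauchy2_def) (metis rat_norm2_minus_commute)

lemma cauchy2_mult:
  assumes "cauchy2 X" "cauchy2 Y"
  shows "cauchy2 (\<lambda>n. X n * Y n)"
proof -
  obtain B0 where B0: "\<And>n. rat_norm2 (X n) \<le> B0" using cauchy2_bounded[OF assms(1)] by blast
  obtain C0 where C0: "\<And>n. rat_norm2 (Y n) \<le> C0" using cauchy2_bounded[OF assms(2)] by blast
  define B where "B = max 1 (max B0 C0)"
  have B: "B > 0" "\<And>n. rat_norm2 (X n) \<le> B" "\<And>n. rat_norm2 (Y n) \<le> B"
    using B0 C0 by (auto simp: B_def le_max_iff_disj)
  show ?thesis
  proof (rule cauchy2_by[where f = "\<lambda>m n. rat_norm2 (X m - X n)" and g = "\<lambda>m n. rat_norm2 (Y m - Y n)"])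
    fix e :: real assume e: "e > 0"
    show "\<exists>d>0. \<forall>m n. rat_norm2 (X m - X n) < d \<longrightarrow> rat_norm2 (Y m - Y n) < d \<longrightarrow>
      rat_norm2 (X m * Y m - X n * Y n) < e"
    proof (intro exI[of _ "e / B"] conjI allI impI)
      fix m n assume mn: "rat_norm2 (X m - X n) < e / B" "rat_norm2 (Y m - Y n) < e / B"
      have "rat_norm2 (X m) * rat_norm2 (Y m - Y n) \<le> B * rat_norm2 (Y m - Y n)"
        using B by (intro mult_right_mono) auto
      also have "\<dots> < e" using mn B by (simp add: field_simps)
      finally have 1: "rat_norm2 (X m * (Y m - Y n)) < e" by (simp add: rat_norm2_mult)
      have "rat_norm2 (X m - X n) * rat_norm2 (Y n) \<le> rat_norm2 (X m - X n) * B"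
        using B by (intro mult_left_mono) auto
      also have "\<dots> < e" using mn B by (simp add: field_simps)
      finally have 2: "rat_norm2 ((X m - X n) * Y n) < e" by (simp add: rat_norm2_mult)
      show "rat_norm2 (X m * Y m - X n * Y n) < e"
        unfolding mult_diff_mult using 1 2
        by (intro le_less_trans[OF rat_norm2_ultra]) simp
    qed (use e B in auto)
  qed (use assms in \<open>auto simp: cauchy2_def\<close>)
qed

lemma cauchy2_away_0:
  assumes "cauchy2 X" "\<not> null2 X"
  obtains b k where "b > 0" "\<And>n. n \<ge> k \<Longrightarrow> rat_norm2 (X n) > b"
proof -
  obtain L where L: "(\<lambda>n. rat_norm2 (X n)) \<longlonglongrightarrow> L"
    using cauchy2_norm_convergent[OF assms(1)] by (auto simp: convergent_def)
  have "L \<ge> 0" by (rule LIMSEQ_le_const[OF L]) auto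
  moreover have "L \<noteq> 0" using L assms(2) by (auto simp: null2_def)
  ultimately have "L > 0" by simp
  then have "\<forall>\<^sub>F n in sequentially. rat_norm2 (X n) > L / 2"
    by (intro order_tendstoD(1)[OF L]) auto
  then obtain k where "\<And>n. n \<ge> k \<Longrightarrow> rat_norm2 (X n) > L / 2"
    by (auto simp: eventually_sequentially)
  then show ?thesis using that[of "L / 2" k] \<open>L > 0\<close> by auto
qed

lemma rat_norm2_inverse_diff:
  assumes "rat_norm2 x > b" "rat_norm2 y > c" "b > 0" "c > 0"
  shows "rat_norm2 (inverse x - inverse y) \<le> rat_norm2 (x - y) / (b * c)"
proof -
  have nz: "x \<noteq> 0" "y \<noteq> 0" using assms by auto
  then have "rat_norm2 (inverse x - inverse y) = rat_norm2 (x - y) / (rat_norm2 x * rat_norm2 y)"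
    by (simp only: inverse_diff_inverse[OF nz] rat_norm2_mult rat_norm2_inverse rat_norm2_minus)
       (simp add: divide_inverse)
  also have "\<dots> \<le> rat_norm2 (x - y) / (b * c)"
    using assms nz by (intro divide_left_mono mult_mono mult_pos_pos) auto
  finally show ?thesis .
qed

lemma cauchy2_inverse:
  assumes "cauchy2 X" "\<not> null2 X"
  shows "cauchy2 (\<lambda>n. inverse (X n))"
  unfolding cauchy2_def
proof (intro allI impI)
  fix e :: real assume e: "e > 0"
  obtain b k where b: "b > 0" "\<And>n. n \<ge> k \<Longrightarrow> rat_norm2 (X n) > b"
    using cauchy2_away_0[OF assms] by metis
  have "e * (b * b) > 0" using e b by simp
  then obtain l where l: "\<And>m n. m \<ge> l \<Longrightarrow> n \<ge> l \<Longrightarrow> rat_norm2 (X m - X n) < e * (b * b)"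
    using assms(1) unfolding cauchy2_def by metis
  show "\<exists>k. \<forall>m\<ge>k. \<forall>n\<ge>k. rat_norm2 (inverse (X m) - inverse (X n)) < e"
  proof (intro exI[of _ "max k l"] allI impI)
    fix m n assume mn: "max k l \<le> m" "max k l \<le> n"
    have "rat_norm2 (inverse (X m) - inverse (X n)) \<le> rat_norm2 (X m - X n) / (b * b)"
      using b mn by (intro rat_norm2_inverse_diff) auto
    also have "\<dots> < e" using l[of m n] mn b by (simp add: divide_less_eq)
    finally show "rat_norm2 (inverse (X m) - inverse (X n)) < e" .
  qed
qed

lemma null2_diff_inverse:
  assumes "cauchy2 X" "\<not> null2 X" "cauchy2 Y" "\<not> null2 Y" "null2 (\<lambda>n. X n - Y n)"
  shows "null2 (\<lambda>n. inverse (X n) - inverse (Y n))"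
proof -
  obtain b k where b: "b > 0" "\<And>n. n \<ge> k \<Longrightarrow> rat_norm2 (X n) > b"
    using cauchy2_away_0[OF assms(1,2)] by metis
  obtain c l where c: "c > 0" "\<And>n. n \<ge> l \<Longrightarrow> rat_norm2 (Y n) > c"
    using cauchy2_away_0[OF assms(3,4)] by metis
  have "(\<lambda>n. rat_norm2 (X n - Y n) / (b * c)) \<longlonglongrightarrow> 0"
    using assms(5) unfolding null2_def by (rule tendsto_divide_zero)
  then show ?thesis unfolding null2_def
    by (rule tendsto_sandwich[OF _ _ tendsto_const, rotated 2])
       (auto simp: eventually_sequentially intro!: exI[of _ "max k l"] rat_norm2_inverse_diff b c)
qed

text \<open>
  The field of 2-adic numbers is the completion of the rationals with respect to the 2-adic
  absolute value: Cauchy sequences modulo null sequences.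
\<close>

definition q2rel :: "(nat \<Rightarrow> rat) \<Rightarrow> (nat \<Rightarrow> rat) \<Rightarrow> bool" where
  "q2rel X Y \<longleftrightarrow> cauchy2 X \<and> cauchy2 Y \<and> null2 (\<lambda>n. X n - Y n)"

lemma q2rel_refl: "q2rel X X \<longleftrightarrow> cauchy2 X"
  by (simp add: q2rel_def null2_def)

lemma part_equivp_q2rel: "part_equivp q2rel"
proof (rule part_equivpI)
  show "\<exists>X. q2rel X X" by (auto simp: q2rel_refl intro: cauchy2_const)
  show "symp q2rel"
    by (auto simp: symp_def q2rel_def null2_def rat_norm2_minus_commute)
  show "transp q2rel"
    unfolding transp_def q2rel_def by (auto dest: null2_add)
qed

quotient_type q2 = "nat \<Rightarrow> rat" / partial: q2rel
  morphisms rep_q2 Q2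
  by (rule part_equivp_q2rel)

lemma Q2_cases: obtains X where "cauchy2 X" "x = Q2 X"
proof -
  have "Quotient3 q2rel Q2 rep_q2" by (rule Quotient3_q2)
  then show ?thesis
    using that[of "rep_q2 x"]
    by (metis Quotient3_def q2rel_refl)
qed

lemma Q2_eq: "cauchy2 X \<Longrightarrow> cauchy2 Y \<Longrightarrow> Q2 X = Q2 Y \<longleftrightarrow> null2 (\<lambda>n. X n - Y n)"
  using Quotient3_rel[OF Quotient3_q2, of X Y] by (auto simp: q2rel_def null2_def)

instantiation q2 :: field
begin

lift_definition zero_q2 :: q2 is "\<lambda>_. 0" by (simp add: q2rel_refl)
lift_definition one_q2 :: q2 is "\<lambda>_. 1" by (simp add: q2rel_refl)
lift_definition plus_q2 :: "q2 \<Rightarrow> q2 \<Rightarrow> q2" is "\<lambda>X Y n. X n + Y n"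
  unfolding q2rel_def add_diff_add by (simp add: cauchy2_add null2_add)
lift_definition uminus_q2 :: "q2 \<Rightarrow> q2" is "\<lambda>X n. - X n"
  unfolding q2rel_def minus_diff_minus by (simp only: cauchy2_minus null2_minus simp_thms)
lift_definition times_q2 :: "q2 \<Rightarrow> q2 \<Rightarrow> q2" is "\<lambda>X Y n. X n * Y n"
proof -
  fix X X' Y Y' assume X: "q2rel X X'" and Y: "q2rel Y Y'"
  obtain B where B: "\<And>n. rat_norm2 (X n) \<le> B"
    using cauchy2_bounded X by (auto simp: q2rel_def)
  obtain C where C: "\<And>n. rat_norm2 (Y' n) \<le> C"
    using cauchy2_bounded Y by (auto simp: q2rel_def)
  have "null2 (\<lambda>n. (Y n - Y' n) * X n)" "null2 (\<lambda>n. (X n - X' n) * Y' n)"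
    using null2_mult[OF _ B] null2_mult[OF _ C] X Y by (auto simp: q2rel_def)
  then have "null2 (\<lambda>n. X n * Y n - X' n * Y' n)"
    unfolding mult_diff_mult by (subst mult.commute) (rule null2_add)
  then show "q2rel (\<lambda>n. X n * Y n) (\<lambda>n. X' n * Y' n)"
    using X Y by (simp add: q2rel_def cauchy2_mult)
qed
lift_definition inverse_q2 :: "q2 \<Rightarrow> q2" is "\<lambda>X. if null2 X then (\<lambda>_. 0) else (\<lambda>n. inverse (X n))"
proof -
  fix X Y assume XY: "q2rel X Y"
  then have "null2 (\<lambda>n. X n - Y n)" by (simp add: q2rel_def)
  then have "null2 X \<longleftrightarrow> null2 Y"
    using null2_add[of "\<lambda>n. X n - Y n" Y] null2_diff[of X "\<lambda>n. X n - Y n"] by auto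
  then show "q2rel (if null2 X then (\<lambda>_. 0) else (\<lambda>n. inverse (X n)))
    (if null2 Y then (\<lambda>_. 0) else (\<lambda>n. inverse (Y n)))"
    using XY by (auto simp: q2rel_def cauchy2_inverse null2_diff_inverse null2_def[of "\<lambda>_. 0"])
qed
definition "x - y = x + - (y :: q2)"
definition "x div y = x * inverse (y :: q2)"

lemma Q2_plus: "cauchy2 X \<Longrightarrow> cauchy2 Y \<Longrightarrow> Q2 X + Q2 Y = Q2 (\<lambda>n. X n + Y n)"
  by (rule plus_q2.abs_eq) (auto simp: q2rel_refl)
lemma Q2_uminus: "cauchy2 X \<Longrightarrow> - Q2 X = Q2 (\<lambda>n. - X n)"
  by (rule uminus_q2.abs_eq) (auto simp: q2rel_refl)
lemma Q2_times: "cauchy2 X \<Longrightarrow> cauchy2 Y \<Longrightarrow> Q2 X * Q2 Y = Q2 (\<lambda>n. X n * Y n)"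
  by (rule times_q2.abs_eq) (auto simp: q2rel_refl)
lemma Q2_inverse: "cauchy2 X \<Longrightarrow> inverse (Q2 X) = (if null2 X then 0 else Q2 (\<lambda>n. inverse (X n)))"
  by (simp add: inverse_q2.abs_eq zero_q2_def q2rel_refl)
lemma Q2_minus: "cauchy2 X \<Longrightarrow> cauchy2 Y \<Longrightarrow> Q2 X - Q2 Y = Q2 (\<lambda>n. X n - Y n)"
  by (simp add: minus_q2_def Q2_uminus Q2_plus cauchy2_minus)

instance
proof
  fix a b c :: q2
  obtain X where X: "cauchy2 X" "a = Q2 X" by (rule Q2_cases)
  obtain Y where Y: "cauchy2 Y" "b = Q2 Y" by (rule Q2_cases)
  obtain Z where Z: "cauchy2 Z" "c = Q2 Z" by (rule Q2_cases)
  note [simp] = X Y Z Q2_plus Q2_times Q2_uminus cauchy2_add cauchy2_mult cauchy2_minus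
  show "a * b * c = a * (b * c)" "a + b + c = a + (b + c)" "a + b = b + a" "a * b = b * a"
    "(a + b) * c = a * c + b * c"
    by (simp_all add: algebra_simps)
  show "1 * a = a" "0 + a = a" "- a + a = 0"
    by (simp_all add: zero_q2_def one_q2_def)
  show "a - b = a + - b" by (rule minus_q2_def)
  show "a div b = a * inverse b" by (rule divide_q2_def)
  show "(0 :: q2) \<noteq> 1" by (simp add: zero_q2_def one_q2_def Q2_eq null2_def LIMSEQ_const_iff)
  show "inverse (0 :: q2) = 0" by (simp add: zero_q2_def[abs_def] Q2_inverse null2_def)
  assume "a \<noteq> 0"
  then have nz: "\<not> null2 X" by (simp add: zero_q2_def Q2_eq)
  obtain e k where b: "e > 0" "\<And>n. n \<ge> k \<Longrightarrow> rat_norm2 (X n) > e"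
    using cauchy2_away_0[OF X(1) nz] by metis
  have "null2 (\<lambda>n. inverse (X n) * X n - 1)"
    unfolding null2_def
  proof (rule tendsto_eventually, unfold eventually_sequentially, intro exI allI impI)
    fix n assume "k \<le> n"
    then have "X n \<noteq> 0" using b(2)[of n] b(1) by auto
    then show "rat_norm2 (inverse (X n) * X n - 1) = 0" by simp
  qed
  then show "inverse a * a = 1"
    using nz by (simp add: Q2_inverse cauchy2_inverse one_q2_def Q2_eq)
qed

end

lift_definition norm2 :: "q2 \<Rightarrow> real" is "\<lambda>X. lim (\<lambda>n. rat_norm2 (X n))"
proof -
  fix X Y assume XY: "q2rel X Y"
  obtain L where L: "(\<lambda>n. rat_norm2 (X n)) \<longlonglongrightarrow> L"
    using cauchy2_norm_convergent[of X] XY unfolding convergent_def q2rel_def by metis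
  have "(\<lambda>n. rat_norm2 (Y n) - rat_norm2 (X n)) \<longlonglongrightarrow> 0"
  proof (rule Lim_null_comparison)
    show "(\<lambda>n. rat_norm2 (X n - Y n)) \<longlonglongrightarrow> 0"
      using XY by (simp add: q2rel_def null2_def)
    show "\<forall>\<^sub>F n in sequentially. norm (rat_norm2 (Y n) - rat_norm2 (X n)) \<le> rat_norm2 (X n - Y n)"
      using rat_norm2_diff_triangle[of "Y _" "X _"] rat_norm2_minus_commute[of "Y _" "X _"]
      by (intro always_eventually allI) simp
  qed
  from tendsto_add[OF this L] have "(\<lambda>n. rat_norm2 (Y n)) \<longlonglongrightarrow> L" by simp
  with L show "lim (\<lambda>n. rat_norm2 (X n)) = lim (\<lambda>n. rat_norm2 (Y n))"
    by (simp add: limI)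
qed

lemma norm2_Q2: "cauchy2 X \<Longrightarrow> (\<lambda>n. rat_norm2 (X n)) \<longlonglongrightarrow> norm2 (Q2 X)"
  using cauchy2_norm_convergent[of X]
  by (simp add: norm2.abs_eq q2rel_refl convergent_LIMSEQ_iff)

lemma norm2_Q2_const: "norm2 (Q2 (\<lambda>_. r)) = rat_norm2 r"
  using norm2_Q2[of "\<lambda>_. r"] by (simp add: LIMSEQ_const_iff)

lemma norm2_nonneg [simp]: "norm2 x \<ge> 0"
proof -
  obtain X where "cauchy2 X" "x = Q2 X" by (rule Q2_cases)
  then show ?thesis using LIMSEQ_le_const[OF norm2_Q2[of X]] by simp
qed

lemma norm2_eq_0 [simp]: "norm2 x = 0 \<longleftrightarrow> x = 0"
proof -
  obtain X where X: "cauchy2 X" "x = Q2 X" by (rule Q2_cases)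
  have "norm2 x = 0 \<longleftrightarrow> null2 X"
    unfolding null2_def X(2) using norm2_Q2[OF X(1)] LIMSEQ_unique[OF norm2_Q2[OF X(1)], of 0] by metis
  then show ?thesis using X by (simp add: zero_q2_def Q2_eq)
qed

lemma norm2_0 [simp]: "norm2 0 = 0" by simp

lemma norm2_1 [simp]: "norm2 1 = 1"
  by (simp add: one_q2_def norm2_Q2_const)

lemma norm2_mult: "norm2 (x * y) = norm2 x * norm2 y"
proof -
  obtain X where X: "cauchy2 X" "x = Q2 X" by (rule Q2_cases)
  obtain Y where Y: "cauchy2 Y" "y = Q2 Y" by (rule Q2_cases)
  have "(\<lambda>n. rat_norm2 (X n * Y n)) \<longlonglongrightarrow> norm2 x * norm2 y"
    unfolding rat_norm2_mult X Y using norm2_Q2 X Y by (intro tendsto_mult)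
  moreover have "(\<lambda>n. rat_norm2 (X n * Y n)) \<longlonglongrightarrow> norm2 (x * y)"
    using norm2_Q2[of "\<lambda>n. X n * Y n"] X Y by (simp add: Q2_times cauchy2_mult)
  ultimately show ?thesis by (rule LIMSEQ_unique[rotated])
qed

lemma norm2_ultra: "norm2 (x + y) \<le> max (norm2 x) (norm2 y)"
proof -
  obtain X where X: "cauchy2 X" "x = Q2 X" by (rule Q2_cases)
  obtain Y where Y: "cauchy2 Y" "y = Q2 Y" by (rule Q2_cases)
  have "(\<lambda>n. max (rat_norm2 (X n)) (rat_norm2 (Y n))) \<longlonglongrightarrow> max (norm2 x) (norm2 y)"
    unfolding X Y using norm2_Q2 X Y by (intro tendsto_max)
  moreover have "(\<lambda>n. rat_norm2 (X n + Y n)) \<longlonglongrightarrow> norm2 (x + y)"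
    using norm2_Q2[of "\<lambda>n. X n + Y n"] X Y by (simp add: Q2_plus cauchy2_add)
  ultimately show ?thesis by (intro LIMSEQ_le[of _ _ "\<lambda>n. max (rat_norm2 (X n)) (rat_norm2 (Y n))"]) (auto simp add: rat_norm2_ultra)
qed

lemma norm2_minus [simp]: "norm2 (- x) = norm2 x"
proof -
  have "norm2 (-1) = 1"
    by (simp add: one_q2_def Q2_uminus norm2_Q2_const)
  then show ?thesis using norm2_mult[of "-1" x] by simp
qed

lemma norm2_minus_commute: "norm2 (x - y) = norm2 (y - x)"
  by (metis minus_diff_eq norm2_minus)

lemma norm2_ultra_diff: "norm2 (x - z) \<le> max (norm2 (x - y)) (norm2 (y - z))"
  using norm2_ultra[of "x - y" "y - z"] by simp

lemma norm2_triangle: "norm2 (x + y) \<le> norm2 x + norm2 y"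
  using norm2_ultra[of x y] norm2_nonneg[of x] norm2_nonneg[of y] by linarith

lemma norm2_inverse: "norm2 (inverse x) = inverse (norm2 x)"
proof (cases "x = 0")
  case False
  then have "norm2 (inverse x) * norm2 x = 1"
    by (simp flip: norm2_mult)
  then show ?thesis using False by (simp add: field_simps)
qed auto

lemma norm2_divide: "norm2 (x / y) = norm2 x / norm2 y"
  by (simp add: divide_inverse norm2_mult norm2_inverse)

lemma norm2_power: "norm2 (x ^ n) = norm2 x ^ n"
  by (induction n) (auto simp: norm2_mult)

lemma norm2_powi: "norm2 (x powi n) = norm2 x powi n"
  by (simp add: power_int_def norm2_power norm2_inverse)

lemma of_nat_Q2: "of_nat n = Q2 (\<lambda>_. of_nat n)"
  by (induction n) (simp_all add: zero_q2_def one_q2_def Q2_plus)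

instance q2 :: field_char_0
proof
  show "inj (of_nat :: nat \<Rightarrow> q2)"
  proof (rule injI)
    fix m n assume "(of_nat m :: q2) = of_nat n"
    then have "null2 (\<lambda>_. of_nat m - of_nat n)" by (simp add: of_nat_Q2 Q2_eq)
    then show "m = n" by (simp add: null2_def LIMSEQ_const_iff)
  qed
qed

lemma of_int_Q2: "of_int n = Q2 (\<lambda>_. of_int n)"
  by (cases n rule: int_cases2) (simp_all add: of_nat_Q2 Q2_uminus)

lemma of_rat_Q2: "of_rat r = Q2 (\<lambda>_. r)"
proof -
  obtain a b where ab: "b \<noteq> 0" "r = of_int a / of_int b" by (rule rat_quot)
  have "of_rat r * of_int b = (of_int a :: q2)"
    using ab by (simp add: of_rat_divide)
  moreover have "Q2 (\<lambda>_. r) * of_int b = of_int a"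
    using ab by (simp add: of_int_Q2 Q2_times)
  ultimately show ?thesis using ab by (metis mult_right_cancel of_int_eq_0_iff)
qed

lemma norm2_of_rat [simp]: "norm2 (of_rat r) = rat_norm2 r"
  by (simp add: of_rat_Q2 norm2_Q2_const)

lemma norm2_of_int_le: "norm2 (of_int a) \<le> 2 powi (- int k) \<longleftrightarrow> 2 ^ k dvd a"
  using norm2_of_rat[of "of_int a"] rat_norm2_int_le[of a k] by simp

lemma norm2_of_int_le_1: "norm2 (of_int a) \<le> 1"
  using norm2_of_int_le[of a 0] by simp

lemma norm2_2 [simp]: "norm2 2 = 1 / 2"
  using norm2_of_rat[of "of_int 2"] rat_norm2_of_int[of 2] 
  by (simp add: multiplicity_same_power')

instantiation q2 :: metric_space
begin

definition dist_q2 :: "q2 \<Rightarrow> q2 \<Rightarrow> real" where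
  "dist_q2 x y = norm2 (x - y)"

definition uniformity_q2 :: "(q2 \<times> q2) filter" where
  "uniformity_q2 = (INF e\<in>{0 <..}. principal {(x, y). dist x y < e})"

definition open_q2 :: "q2 set \<Rightarrow> bool" where
  "open_q2 U = (\<forall>x\<in>U. eventually (\<lambda>(x', y). x' = x \<longrightarrow> y \<in> U) uniformity)"

instance
proof
  fix x y z :: q2
  show "dist x y = 0 \<longleftrightarrow> x = y" by (simp add: dist_q2_def)
  show "dist x y \<le> dist x z + dist y z"
    using norm2_triangle[of "x - z" "z - y"] by (simp add: dist_q2_def norm2_minus_commute[of z y])
qed (simp_all add: uniformity_q2_def open_q2_def)

end

instance q2 :: topological_ab_group_add
proof
  fix a b :: q2
  show "((\<lambda>x. fst x + snd x) \<longlongrightarrow> a + b) (nhds a \<times>\<^sub>F nhds b)"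
    unfolding tendsto_iff
  proof (intro allI impI)
    fix e :: real assume e: "e > 0"
    have "eventually (\<lambda>x. dist x a < e) (nhds a)" "eventually (\<lambda>x. dist x b < e) (nhds b)"
      using e by (auto simp: eventually_nhds_metric)
    then have "eventually (\<lambda>x. dist (fst x) a < e \<and> dist (snd x) b < e) (nhds a \<times>\<^sub>F nhds b)"
      by (auto simp: eventually_prod_filter)
    then show "eventually (\<lambda>x. dist (fst x + snd x) (a + b) < e) (nhds a \<times>\<^sub>F nhds b)"
    proof eventually_elim
      case (elim x)
      then show ?case
        using norm2_ultra[of "fst x - a" "snd x - b"] by (simp only: dist_q2_def add_diff_add) linarith
    qed
  qed
  show "(uminus \<longlongrightarrow> - a) (nhds a)"
    unfolding tendsto_iff
    by (auto simp: eventually_nhds_metric dist_q2_def norm2_minus_commute[of a])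
qed

lemma Q2_LIMSEQ:
  assumes "cauchy2 X"
  shows "(\<lambda>n. of_rat (X n)) \<longlonglongrightarrow> Q2 X"
proof (rule metric_LIMSEQ_I)
  fix e :: real assume "e > 0"
  then obtain k where k: "\<And>m n. m \<ge> k \<Longrightarrow> n \<ge> k \<Longrightarrow> rat_norm2 (X m - X n) < e / 2"
    using assms unfolding cauchy2_def by (meson half_gt_zero)
  show "\<exists>k. \<forall>n\<ge>k. dist (of_rat (X n)) (Q2 X) < e"
  proof (intro exI allI impI)
    fix n assume n: "n \<ge> k"
    have c: "cauchy2 (\<lambda>m. X n - X m)"
      using cauchy2_add[OF cauchy2_const cauchy2_minus[OF assms]] by simp
    have "dist (of_rat (X n)) (Q2 X) = norm2 (Q2 (\<lambda>m. X n - X m))"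
      using assms by (simp add: dist_q2_def of_rat_Q2 Q2_minus)
    also have "\<dots> \<le> e / 2"
      using norm2_Q2[OF c] k[OF n] by (intro LIMSEQ_le_const2) (auto intro: less_imp_le)
    also have "\<dots> < e" using \<open>e > 0\<close> by simp
    finally show "dist (of_rat (X n)) (Q2 X) < e" .
  qed
qed

lemma q2_rat_dense:
  assumes "e > 0"
  obtains r where "norm2 (x - of_rat r) < e"
proof -
  obtain X where X: "cauchy2 X" "x = Q2 X" by (rule Q2_cases)
  obtain n where "dist (of_rat (X n)) (Q2 X) < e"
    using metric_LIMSEQ_D[OF Q2_LIMSEQ[OF X(1)] assms] by blast
  then show ?thesis
    using that[of "X n"] X by (simp add: dist_q2_def norm2_minus_commute)
qed

instance q2 :: complete_space
proof
  fix X :: "nat \<Rightarrow> q2" assume X: "Cauchy X"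
  have "\<exists>r. norm2 (X n - of_rat r) < inverse (real (Suc n))" for n
    by (rule q2_rat_dense[of "inverse (real (Suc n))" "X n"]) auto
  then obtain r where r: "\<And>n. norm2 (X n - of_rat (r n)) < inverse (real (Suc n))" by metis
  have null: "(\<lambda>n. norm2 (X n - of_rat (r n))) \<longlonglongrightarrow> 0"
    by (rule tendsto_sandwich[OF _ _ tendsto_const LIMSEQ_inverse_real_of_nat])
       (simp_all del: of_nat_Suc add: less_imp_le[OF r])
  have "cauchy2 r"
    unfolding cauchy2_def
  proof (intro allI impI)
    fix e :: real assume e: "e > 0"
    obtain k where k: "\<And>m n. m \<ge> k \<Longrightarrow> n \<ge> k \<Longrightarrow> dist (X m) (X n) < e"
      using metric_CauchyD[OF X e] by metis
    obtain l where l: "\<And>n. n \<ge> l \<Longrightarrow> norm2 (X n - of_rat (r n)) < e"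
      using order_tendstoD(2)[OF null e] unfolding eventually_sequentially by metis
    show "\<exists>k. \<forall>m\<ge>k. \<forall>n\<ge>k. rat_norm2 (r m - r n) < e"
    proof (intro exI[of _ "max k l"] allI impI)
      fix m n assume mn: "max k l \<le> m" "max k l \<le> n"
      have "norm2 (of_rat (r m) - of_rat (r n)) < e"
        using norm2_ultra_diff[of "of_rat (r m)" "of_rat (r n)" "X m"]
          norm2_ultra_diff[of "X m" "of_rat (r n)" "X n"] l[of m] l[of n] k[of m n] mn
          norm2_minus_commute[of "X m" "of_rat (r m)"]
        unfolding dist_q2_def by linarith
      then show "rat_norm2 (r m - r n) < e"
        by (metis norm2_of_rat of_rat_diff)
    qed
  qed
  then have 1: "(\<lambda>n. of_rat (r n)) \<longlonglongrightarrow> Q2 r" by (rule Q2_LIMSEQ)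
  have "X \<longlonglongrightarrow> Q2 r"
  proof -
    have "(\<lambda>n. X n - of_rat (r n)) \<longlonglongrightarrow> 0"
      using null by (subst tendsto_dist_iff) (simp add: dist_q2_def)
    from tendsto_add[OF this 1] show ?thesis by simp
  qed
  then show "convergent X" by (auto simp: convergent_def)
qed

instance q2 :: second_countable_topology
proof
  define B where "B = (\<lambda>(r, n). ball (of_rat r :: q2) (inverse (real (Suc n)))) ` (UNIV :: (rat \<times> nat) set)"
  have "topological_basis B"
  proof (rule topological_basisI)
    fix U :: "q2 set" and x assume U: "open U" "x \<in> U"
    then obtain e where e: "e > 0" "ball x e \<subseteq> U" by (meson open_contains_ball)
    obtain n where n: "inverse (real (Suc n)) < e" using reals_Archimedean[OF e(1)] by blast
    obtain r where r: "norm2 (x - of_rat r) < inverse (real (Suc n))"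
      by (rule q2_rat_dense[of "inverse (real (Suc n))" x]) auto
    have "ball (of_rat r) (inverse (real (Suc n))) \<subseteq> ball x e"
    proof
      fix y :: q2 assume "y \<in> ball (of_rat r) (inverse (real (Suc n)))"
      then show "y \<in> ball x e"
        using norm2_ultra_diff[of x y "of_rat r"] r n by (auto simp: dist_q2_def)
    qed
    moreover have "x \<in> ball (of_rat r) (inverse (real (Suc n)))"
      using r by (simp add: dist_q2_def norm2_minus_commute)
    ultimately show "\<exists>B'\<in>B. x \<in> B' \<and> B' \<subseteq> U"
      using e(2) unfolding B_def
      by (intro bexI[of _ "ball (of_rat r) (inverse (real (Suc n)))"] conjI image_eqI[of _ _ "(r, n)"]) simp_all
  next
    fix U assume "U \<in> B"
    then obtain p where "U = (\<lambda>(r, n). ball (of_rat r :: q2) (inverse (real (Suc n)))) p"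
      unfolding B_def by (elim imageE)
    then show "open U" by (cases p) simp
  qed
  moreover have "countable B" by (simp add: B_def)
  ultimately show "\<exists>B :: q2 set set. countable B \<and> open = generate_topology B"
    using topological_basis_imp_subbasis by blast
qed

instance q2 :: polish_space ..

text \<open>
  The set of numbers $2^{-\gamma}(a_0 + a_1 2 + \dots + a_{\gamma-1} 2^{\gamma-1})$ with binary
  digits $a_j$. It is used both as a set of rationals (the possible values of the fractional part)
  and as a set of 2-adic numbers (the index set $I_2$).
\<close>

definition dyadic_fracs :: "'a::field set" where
  "dyadic_fracs = {(\<Sum>i<\<gamma>. of_nat (a i) * 2 ^ i) / 2 ^ \<gamma> | \<gamma> a. \<forall>i. a i \<in> {0, 1 :: nat}}"

lemma binary_digits:
  assumes "c < 2 ^ g"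
  shows "\<exists>a. (\<forall>i. a i \<in> {0, 1 :: nat}) \<and> c = (\<Sum>i<g. a i * 2 ^ i)"
  using assms
proof (induction g arbitrary: c)
  case 0
  then show ?case by (intro exI[of _ "\<lambda>_. 0"]) auto
next
  case (Suc g)
  have "c mod 2 ^ g < 2 ^ g" by simp
  from Suc.IH[OF this] obtain a where
    a: "\<forall>i. a i \<in> {0, 1 :: nat}" "c mod 2 ^ g = (\<Sum>i<g. a i * 2 ^ i)" by blast
  have "c div 2 ^ g < 2" using Suc.prems by (simp add: less_mult_imp_div_less)
  then have d: "c div 2 ^ g \<in> {0, 1}" by auto
  have "(\<Sum>i<g. (a(g := c div 2 ^ g)) i * 2 ^ i) = (\<Sum>i<g. a i * 2 ^ i)"
    by (intro sum.cong) auto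
  then have "(\<Sum>i<Suc g. (a(g := c div 2 ^ g)) i * 2 ^ i) = c mod 2 ^ g + c div 2 ^ g * 2 ^ g"
    unfolding a(2) by simp
  then have "c = (\<Sum>i<Suc g. (a(g := c div 2 ^ g)) i * 2 ^ i)"
    by (simp only: mod_div_mult_eq)
  then show ?case using a(1) d by (intro exI[of _ "a(g := c div 2 ^ g)"]) auto
qed

lemma binary_digits_less:
  assumes "\<forall>i. a i \<in> {0, 1 :: nat}"
  shows "(\<Sum>i<g. a i * 2 ^ i) < 2 ^ g"
proof (induction g)
  case (Suc g)
  have "a g * 2 ^ g \<le> 1 * 2 ^ g"
    using assms by (intro mult_right_mono) (auto dest: spec[of _ g])
  moreover have "(\<Sum>i<Suc g. a i * 2 ^ i) = (\<Sum>i<g. a i * 2 ^ i) + a g * 2 ^ g" by simp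
  ultimately show ?case using Suc unfolding power_Suc by linarith
qed auto

lemma dyadic_fracs_altdef: "dyadic_fracs = {of_nat c / 2 ^ g | c g. c < 2 ^ g}"
proof (intro equalityI subsetI)
  fix x :: 'a assume "x \<in> dyadic_fracs"
  then obtain g a where a: "\<forall>i. a i \<in> {0, 1 :: nat}" "x = (\<Sum>i<g. of_nat (a i) * 2 ^ i) / 2 ^ g"
    by (auto simp: dyadic_fracs_def)
  have "x = of_nat (\<Sum>i<g. a i * 2 ^ i) / 2 ^ g" using a(2) by simp
  with binary_digits_less[OF a(1), of g] show "x \<in> {of_nat c / 2 ^ g | c g. c < 2 ^ g}" by blast
next
  fix x :: 'a assume "x \<in> {of_nat c / 2 ^ g | c g. c < 2 ^ g}"
  then obtain c g where c: "c < 2 ^ g" "x = of_nat c / 2 ^ g" by blast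
  obtain a where a: "\<forall>i. a i \<in> {0, 1 :: nat}" "c = (\<Sum>i<g. a i * 2 ^ i)"
    using binary_digits[OF c(1)] by blast
  have "x = (\<Sum>i<g. of_nat (a i) * 2 ^ i) / 2 ^ g" using c(2) a(2) by simp
  with a(1) show "x \<in> dyadic_fracs" unfolding dyadic_fracs_def by blast
qed

lemma dyadic_fracs_of_rat: "(dyadic_fracs :: q2 set) = of_rat ` dyadic_fracs"
proof -
  have *: "of_rat (of_nat c / 2 ^ g) = (of_nat c / 2 ^ g :: q2)" for c g
    by (simp add: of_rat_divide of_rat_power)
  show ?thesis
  proof (intro equalityI subsetI)
    fix x :: q2 assume "x \<in> dyadic_fracs"
    then obtain c g where "x = of_nat c / 2 ^ g" "c < 2 ^ g" unfolding dyadic_fracs_altdef by blast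
    then show "x \<in> of_rat ` dyadic_fracs"
      unfolding dyadic_fracs_altdef using * by (intro image_eqI[of _ _ "of_nat c / 2 ^ g"]) (simp, blast)
  next
    fix x :: q2 assume "x \<in> of_rat ` dyadic_fracs"
    then obtain y :: rat where y: "x = of_rat y" "y \<in> dyadic_fracs" by blast
    then obtain c g where "y = of_nat c / 2 ^ g" "c < 2 ^ g" unfolding dyadic_fracs_altdef by blast
    then show "x \<in> dyadic_fracs" unfolding y(1) dyadic_fracs_altdef using * by blast
  qed
qed

definition Z2 :: "q2 set" where
  "Z2 = {x. norm2 x \<le> 1}"

lemma Z2_approx:
  assumes "norm2 t \<le> 1"
  obtains c :: nat where "c < 2 ^ k" "norm2 (t - of_nat c) \<le> 2 powi (- int k)"
proof -
  obtain r where r: "norm2 (t - of_rat r) < 2 powi (- int k)"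
    by (rule q2_rat_dense[of "2 powi (- int k)" t]) auto
  have p1: "(2::real) powi (- int k) \<le> 1"
    using power_int_increasing[of "- int k" 0 "2::real"] by simp
  have r1: "rat_norm2 r \<le> 1"
    using norm2_ultra_diff[of "of_rat r" 0 t] r p1 assms by (simp add: norm2_minus_commute)
  obtain a b where ab: "quotient_of r = (a, b)" by (cases "quotient_of r")
  have b: "b > 0" and cop: "coprime a b" and rab: "r = of_int a / of_int b"
    using quotient_of_denom_pos[OF ab] quotient_of_coprime[OF ab] quotient_of_div[OF ab] by auto
  have odd: "odd b"
  proof
    assume ev: "even b"
    then have "odd a" using cop by (metis coprime_def dvd_refl not_is_unit_0 odd_one coprime_common_divisor)
    then have "rat_norm2 (of_int a) = 1"
      using rat_norm2_of_int[of a] by (cases "a = 0") (auto simp: not_dvd_imp_multiplicity_0)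
    moreover have "rat_norm2 (of_int b) \<le> 1 / 2"
      using rat_norm2_int_le[of b 1] ev by simp
    moreover have "rat_norm2 (of_int a) = rat_norm2 r * rat_norm2 (of_int b)"
      using rab b by (simp flip: rat_norm2_mult)
    ultimately show False
      using r1 mult_mono[of "rat_norm2 r" 1 "rat_norm2 (of_int b)" "1/2"] by simp
  qed
  then have "coprime b (2 ^ k)" by simp
  then obtain b' where b': "[b * b' = 1] (mod 2 ^ k)" using cong_solve_coprime_int by blast
  define c where "c = nat ((a * b') mod 2 ^ k)"
  have c: "int c = (a * b') mod 2 ^ k" by (simp add: c_def)
  have "[b * int c = b * (a * b')] (mod 2 ^ k)"
    unfolding c by (metis cong_def cong_scalar_left mod_mod_trivial)
  also have "b * (a * b') = a * (b * b')" by simp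
  also have "[a * (b * b') = a * 1] (mod 2 ^ k)" using b' by (rule cong_scalar_left)
  finally have "2 ^ k dvd a - b * int c" by (simp add: cong_iff_dvd_diff dvd_diff_commute)
  then have n1: "norm2 (of_int (a - b * int c)) \<le> 2 powi (- int k)"
    by (simp only: norm2_of_int_le)
  have nb: "norm2 (of_int b) = 1"
    using norm2_of_rat[of "of_int b"] rat_norm2_of_int[of b] odd b
    by (simp add: not_dvd_imp_multiplicity_0)
  have "of_rat r - of_nat c = (of_int (a - b * int c) / of_int b :: q2)"
    using b unfolding rab by (simp add: of_rat_divide field_simps)
  then have "norm2 (of_rat r - of_nat c) \<le> 2 powi (- int k)"
    using n1 nb by (simp add: norm2_divide)
  then have 1: "norm2 (t - of_nat c) \<le> 2 powi (- int k)"
    using norm2_ultra_diff[of t "of_nat c" "of_rat r"] r by linarith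
  have "int c < 2 ^ k" unfolding c by simp
  then have "c < 2 ^ k" by (metis of_nat_less_iff of_nat_numeral of_nat_power)
  with 1 show ?thesis using that by blast
qed

lemma q2_scale_Z2: obtains g :: nat where "norm2 (2 ^ g * t) \<le> 1"
proof -
  obtain g where "norm2 t < 2 ^ g" using real_arch_pow[of 2 "norm2 t"] by auto
  then show ?thesis using that[of g] by (simp add: norm2_mult norm2_power power_one_over field_simps)
qed

lemma ex1_fractional_part: "\<exists>!r. r \<in> dyadic_fracs \<and> t - of_rat r \<in> Z2"
proof -
  obtain g where g: "norm2 (2 ^ g * t) \<le> 1" by (rule q2_scale_Z2)
  obtain c where c: "c < 2 ^ g" "norm2 (2 ^ g * t - of_nat c) \<le> 2 powi (- int g)"
    using Z2_approx[OF g] by metis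
  have p: "2 powi (- int g) = inverse (2 ^ g :: real)" by (simp add: power_int_minus)
  have "2 ^ g * t - of_nat c = 2 ^ g * (t - of_rat (of_nat c / 2 ^ g))"
    by (simp add: of_rat_divide of_rat_power right_diff_distrib)
  then have "norm2 (2 ^ g * t - of_nat c) = norm2 (t - of_rat (of_nat c / 2 ^ g)) / 2 ^ g"
    by (simp only: norm2_mult norm2_power norm2_2) (simp add: power_one_over)
  then have "norm2 (t - of_rat (of_nat c / 2 ^ g)) \<le> 1"
    using c(2) unfolding p by (simp add: field_simps)
  then have ex: "of_nat c / 2 ^ g \<in> (dyadic_fracs :: rat set)" "t - of_rat (of_nat c / 2 ^ g) \<in> Z2"
    using c(1) unfolding dyadic_fracs_altdef Z2_def by auto
  have uniq: "r = s" if rs: "r \<in> dyadic_fracs" "t - of_rat r \<in> Z2" "s \<in> dyadic_fracs" "t - of_rat s \<in> Z2" for r s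
  proof -
    obtain c g d h where r: "r = of_nat c / 2 ^ g" "c < 2 ^ g" and s: "s = of_nat d / 2 ^ h" "d < 2 ^ h"
      using rs unfolding dyadic_fracs_altdef by blast
    have frac01: "0 \<le> (of_nat c / 2 ^ g :: rat)" "(of_nat c / 2 ^ g :: rat) < 1" if "c < 2 ^ g" for c g
    proof -
      have "(of_nat c :: rat) < of_nat (2 ^ g)" using that by (simp only: of_nat_less_iff)
      then show "(of_nat c / 2 ^ g :: rat) < 1" by (simp add: divide_less_eq)
    qed simp
    define m where "m = int c * 2 ^ h - int d * 2 ^ g"
    have "norm2 (of_rat (r - s)) \<le> 1"
      using norm2_ultra_diff[of "of_rat r" "of_rat s" t] rs
      by (simp add: of_rat_diff Z2_def norm2_minus_commute[of t])
    moreover have m: "of_int m = (r - s) * 2 ^ (g + h)"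
      by (simp add: m_def r s field_simps power_add)
    moreover have n2: "rat_norm2 (2 ^ (g + h)) = 2 powi (- int (g + h))"
      using norm2_of_rat[of "2 ^ (g + h)"]
      by (simp only: power_int_minus power_int_of_nat) (simp add: of_rat_power norm2_power power_one_over inverse_eq_divide)
    ultimately have "rat_norm2 (of_int m) \<le> 2 powi (- int (g + h))"
      by (simp add: rat_norm2_mult mult_left_le_one_le)
    then have "2 ^ (g + h) dvd m" by (simp only: rat_norm2_int_le)
    then obtain l where "m = 2 ^ (g + h) * l" by (elim dvdE)
    then have "(r - s) * 2 ^ (g + h) = of_int l * 2 ^ (g + h)" using m by simp
    then have l: "r - s = of_int l" by simp
    have "0 \<le> r" "r < 1" "0 \<le> s" "s < 1"
      using frac01[OF r(2)] frac01[OF s(2)] r(1) s(1) by auto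
    then have "\<bar>of_int l :: rat\<bar> < 1" using l by linarith
    then have "l = 0" by linarith
    then show "r = s" using l by simp
  qed
  show ?thesis using ex uniq by blast
qed

definition q2_coset :: "q2 \<Rightarrow> nat \<Rightarrow> q2 set" where
  "q2_coset c k = {x. norm2 (x - c) \<le> 2 powi (- int k)}"

lemma q2_coset_eq:
  assumes "x \<in> q2_coset c k"
  shows "q2_coset x k = q2_coset c k"
proof -
  have x: "norm2 (x - c) \<le> 2 powi (- int k)" using assms by (simp add: q2_coset_def)
  then have x': "norm2 (c - x) \<le> 2 powi (- int k)" by (subst norm2_minus_commute)
  have "norm2 (y - x) \<le> 2 powi (- int k) \<longleftrightarrow> norm2 (y - c) \<le> 2 powi (- int k)" for y
    using x x' norm2_ultra_diff[of y x c] norm2_ultra_diff[of y c x] by linarith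
  then show ?thesis by (simp add: q2_coset_def)
qed

lemma q2_coset_self: "c \<in> q2_coset c k"
  by (simp add: q2_coset_def)

lemma q2_coset_mono: "k \<le> l \<Longrightarrow> q2_coset c l \<subseteq> q2_coset c k"
  using power_int_increasing[of "- int l" "- int k" "2::real"] by (auto simp: q2_coset_def)

lemma q2_coset_Int: "k \<le> l \<Longrightarrow> q2_coset c k \<inter> q2_coset d l \<in> {{}, q2_coset d l}"
  using q2_coset_eq[of _ c k] q2_coset_eq[of _ d l] q2_coset_mono[of k l] by blast

lemma open_q2_coset: "open (q2_coset c k)"
  unfolding open_dist
proof (intro ballI exI[of _ "2 powi (- int k)"] conjI allI impI)
  fix x y assume x: "x \<in> q2_coset c k" and y: "dist y x < 2 powi (- int k)"
  have "y \<in> q2_coset x k" using y by (simp add: q2_coset_def dist_q2_def)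
  then show "y \<in> q2_coset c k" using q2_coset_eq[OF x] by simp
qed simp

lemma Z2_eq_coset: "Z2 = q2_coset 0 0"
  by (simp add: Z2_def q2_coset_def)

lemma q2_coset_basis: "topological_basis (range (\<lambda>(r, k). q2_coset (of_rat r) k))"
proof (rule topological_basisI)
  fix U :: "q2 set" and x assume U: "open U" "x \<in> U"
  then obtain e where e: "e > 0" "\<And>y. dist y x < e \<Longrightarrow> y \<in> U" unfolding open_dist by metis
  obtain k where k: "(1 / 2) ^ k < e" using real_arch_pow_inv[OF e(1), of "1/2"] by auto
  have k': "2 powi (- int k) < e" using k by (simp add: power_int_minus power_one_over inverse_eq_divide)
  obtain r where "norm2 (x - of_rat r) < 2 powi (- int k)"
    by (rule q2_rat_dense[of "2 powi (- int k)" x]) auto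
  then have x: "x \<in> q2_coset (of_rat r) k" by (simp add: q2_coset_def)
  have "q2_coset x k \<subseteq> U"
    using k' by (auto simp: q2_coset_def dist_q2_def intro: e(2))
  then have "x \<in> q2_coset (of_rat r) k \<and> q2_coset (of_rat r) k \<subseteq> U"
    using x q2_coset_eq[OF x] by simp
  then show "\<exists>B'\<in>range (\<lambda>(r, k). q2_coset (of_rat r) k). x \<in> B' \<and> B' \<subseteq> U"
    by (intro bexI[of _ "q2_coset (of_rat r) k"] image_eqI[of _ _ "(r, k)"]) simp_all
next
  fix B assume "B \<in> range (\<lambda>(r, k). q2_coset (of_rat r) k)"
  then obtain p where "B = (\<lambda>(r, k). q2_coset (of_rat r) k) p" by (elim imageE)
  then show "open B" by (cases p) (simp add: open_q2_coset)
qed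

lemma borel_q2: "(borel :: q2 measure) = sigma UNIV (range (\<lambda>(r, k). q2_coset (of_rat r) k))"
  by (rule borel_eq_countable_basis[OF _ q2_coset_basis]) simp

lemma sets_borel_q2:
  "sets (borel :: q2 measure) = sigma_sets UNIV (insert {} (range (\<lambda>(c, k). q2_coset c k)))" (is "_ = sigma_sets _ ?E")
proof (rule antisym)
  have "sets (borel :: q2 measure) = sigma_sets UNIV (range (\<lambda>(r, k). q2_coset (of_rat r) k))"
    by (subst borel_q2) (rule sets_measure_of, simp)
  also have "range (\<lambda>(r, k). q2_coset (of_rat r) k) \<subseteq> ?E" by auto
  then have "sigma_sets UNIV (range (\<lambda>(r, k). q2_coset (of_rat r) k)) \<subseteq> sigma_sets UNIV ?E"
    by (rule sigma_sets_subseteq)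
  finally show "sets (borel :: q2 measure) \<subseteq> sigma_sets UNIV ?E" .
  have "?E \<subseteq> sets (borel :: q2 measure)" by (auto intro: borel_open open_q2_coset)
  then have "sigma_sets (space (borel :: q2 measure)) ?E \<subseteq> sets (borel :: q2 measure)"
    by (rule sets.sigma_sets_subset)
  then show "sigma_sets UNIV ?E \<subseteq> sets (borel :: q2 measure)" by simp
qed

lemma q2_measure_eqI:
  assumes "sets M = sets borel" "sets N = sets borel"
    and "\<And>c k. emeasure M (q2_coset c k) = emeasure N (q2_coset c k)"
    and "\<And>c. emeasure M (q2_coset c 0) \<noteq> \<infinity>"
  shows "M = N"
proof (rule measure_eqI_generator_eq)
  let ?E = "insert {} (range (\<lambda>(c, k). q2_coset c k))"
  show "Int_stable ?E"
  proof (rule Int_stableI)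
    fix A B assume AB: "A \<in> ?E" "B \<in> ?E"
    show "A \<inter> B \<in> ?E"
    proof (cases "A = {} \<or> B = {}")
      case False
      then obtain c k d l where *: "A = q2_coset c k" "B = q2_coset d l" using AB by auto
      have "A \<inter> B \<in> {{}, A, B}"
        using q2_coset_Int[of k l c d] q2_coset_Int[of l k d c] linear[of k l]
        unfolding * by (auto simp: Int_commute)
      then show ?thesis using AB by auto
    qed auto
  qed
  have "sets (borel :: q2 measure) = sigma_sets UNIV ?E"
    by (rule sets_borel_q2)
  then show "sets M = sigma_sets UNIV ?E" "sets N = sigma_sets UNIV ?E"
    using assms by simp_all
  show "emeasure M X = emeasure N X" if "X \<in> ?E" for X
    using that assms(3) by auto
  show "range (\<lambda>i. q2_coset (of_rat (from_nat i)) 0) \<subseteq> ?E" by auto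
  show "(\<Union>i. q2_coset (of_rat (from_nat i)) 0) = UNIV"
  proof (intro equalityI subsetI UNIV_I)
    fix x :: q2
    obtain r where r: "norm2 (x - of_rat r) < 1" by (rule q2_rat_dense[of 1 x]) auto
    then have "x \<in> q2_coset (of_rat (from_nat (to_nat r))) 0" by (simp add: q2_coset_def)
    then show "x \<in> (\<Union>i. q2_coset (of_rat (from_nat i)) 0)" by blast
  qed
  show "emeasure M (q2_coset (of_rat (from_nat i)) 0) \<noteq> \<infinity>" for i by (rule assms(4))
qed simp

text \<open>
  Translation-invariant Borel measures on the 2-adic numbers that give the 2-adic integers
  mass 1. There is exactly one, see \<open>ex1_haar_normalized\<close> below.
\<close>

definition haar_normalized :: "q2 measure \<Rightarrow> bool" where
  "haar_normalized M \<longleftrightarrow> sets M = sets borel \<and>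
     (\<forall>t. \<forall>A\<in>sets borel. emeasure M ((+) t ` A) = emeasure M A) \<and> emeasure M Z2 = 1"

lemma q2_coset_translate: "(+) t ` q2_coset c k = q2_coset (t + c) k"
proof (intro equalityI subsetI)
  fix x assume "x \<in> q2_coset (t + c) k"
  then show "x \<in> (+) t ` q2_coset c k"
    by (intro image_eqI[of _ _ "x - t"]) (auto simp: q2_coset_def algebra_simps)
qed (auto simp: q2_coset_def)

lemma q2_coset_measurable [measurable]: "q2_coset c k \<in> sets borel"
  by (simp add: borel_open open_q2_coset)

lemma of_nat_in_q2_coset: "of_nat m \<in> q2_coset (of_nat n) k \<longleftrightarrow> m mod 2 ^ k = n mod 2 ^ k"
proof -
  have "of_nat m - of_nat n = (of_int (int m - int n) :: q2)" by simp
  then have "of_nat m \<in> q2_coset (of_nat n) k \<longleftrightarrow> 2 ^ k dvd int m - int n"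
    unfolding q2_coset_def by (simp only: mem_Collect_eq norm2_of_int_le)
  also have "\<dots> \<longleftrightarrow> int m mod 2 ^ k = int n mod 2 ^ k"
    by (simp add: mod_eq_dvd_iff)
  also have "\<dots> \<longleftrightarrow> m mod 2 ^ k = n mod 2 ^ k"
    by (metis of_nat_eq_iff zmod_int of_nat_numeral of_nat_power)
  finally show ?thesis .
qed

lemma Z2_partition: "Z2 = (\<Union>j<2 ^ k. q2_coset (of_nat j) k)"
proof (intro equalityI subsetI)
  fix t assume "t \<in> Z2"
  then obtain c where "c < 2 ^ k" "norm2 (t - of_nat c) \<le> 2 powi (- int k)"
    using Z2_approx[of t k] by (auto simp: Z2_def)
  then show "t \<in> (\<Union>j<2 ^ k. q2_coset (of_nat j) k)" by (auto simp: q2_coset_def)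
next
  fix t assume "t \<in> (\<Union>j<2 ^ k. q2_coset (of_nat j) k)"
  then obtain j where "t \<in> q2_coset (of_nat j) k" by blast
  then have t: "t \<in> q2_coset (of_nat j) 0" using q2_coset_mono[of 0 k] by blast
  have "of_nat j \<in> q2_coset (of_nat 0) 0" by (simp only: of_nat_in_q2_coset) simp
  from q2_coset_eq[OF this] have "q2_coset (of_nat j) 0 = q2_coset 0 0" by simp
  then show "t \<in> Z2" using t by (simp add: Z2_eq_coset)
qed

lemma haar_normalized_coset:
  assumes "haar_normalized M"
  shows "emeasure M (q2_coset c k) = ennreal (1 / 2 ^ k)"
proof -
  have M: "sets M = sets borel" and tr: "\<And>t A. A \<in> sets borel \<Longrightarrow> emeasure M ((+) t ` A) = emeasure M A"
    and Z: "emeasure M Z2 = 1"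
    using assms by (auto simp: haar_normalized_def)
  have all: "emeasure M (q2_coset d k) = emeasure M (q2_coset 0 k)" for d
    using tr[of "q2_coset 0 k" d] by (simp add: q2_coset_translate)
  have disj: "disjoint_family_on (\<lambda>j. q2_coset (of_nat j) k) {..<2 ^ k}"
    unfolding disjoint_family_on_def
  proof (intro ballI impI)
    fix m n :: nat assume mn: "m \<in> {..<2 ^ k}" "n \<in> {..<2 ^ k}" "m \<noteq> n"
    show "q2_coset (of_nat m) k \<inter> q2_coset (of_nat n) k = {}"
    proof (rule ccontr)
      assume "q2_coset (of_nat m) k \<inter> q2_coset (of_nat n) k \<noteq> {}"
      then have "q2_coset (of_nat m) k = q2_coset (of_nat n) k" using q2_coset_eq by blast
      then have "of_nat m \<in> q2_coset (of_nat n) k" using q2_coset_self by blast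
      then show False using mn by (simp add: of_nat_in_q2_coset)
    qed
  qed
  have "1 = emeasure M (\<Union>j<2 ^ k. q2_coset (of_nat j) k)"
    using Z Z2_partition[of k] by simp
  also have "\<dots> = (\<Sum>j<2 ^ k. emeasure M (q2_coset (of_nat j) k))"
    using disj by (intro sum_emeasure[symmetric]) (auto simp: M)
  also have "\<dots> = of_nat (2 ^ k) * emeasure M (q2_coset 0 k)"
    by (subst all) simp
  finally have 1: "of_nat (2 ^ k) * emeasure M (q2_coset 0 k) = 1" by simp
  have "emeasure M (q2_coset 0 k) \<noteq> \<infinity>"
  proof
    assume "emeasure M (q2_coset 0 k) = \<infinity>"
    then show False using 1 by (simp add: ennreal_mult_top)
  qed
  then obtain x where x: "x \<ge> 0" "emeasure M (q2_coset 0 k) = ennreal x"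
    by (cases "emeasure M (q2_coset 0 k)") auto
  have "ennreal (real (2 ^ k) * x) = of_nat (2 ^ k) * ennreal x"
    by (subst ennreal_mult) (simp_all only: x ennreal_of_nat_eq_real_of_nat of_nat_0_le_iff)
  also have "\<dots> = ennreal 1" using 1 x(2) by simp
  finally have "real (2 ^ k) * x = 1" using x(1) by (subst (asm) ennreal_inj) auto
  then have "2 ^ k * x = 1" by simp
  then show ?thesis using all[of c] x by (simp add: field_simps)
qed

text \<open>
  Existence of the Haar measure: it is the image of Lebesgue measure on the nonnegative reals
  under the map that reverses the binary digits of the part in the unit interval and sends the
  integer part to a coset of the 2-adic integers.
\<close>

definition rbit :: "nat \<Rightarrow> real \<Rightarrow> nat" where
  "rbit i u = nat \<lfloor>2 ^ Suc i * u\<rfloor> mod 2"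

definition rev_digits :: "nat \<Rightarrow> real \<Rightarrow> nat" where
  "rev_digits k u = (\<Sum>i<k. rbit i u * 2 ^ i)"

lemma rev_digits_less: "rev_digits k u < 2 ^ k"
  unfolding rev_digits_def by (rule binary_digits_less) (auto simp: rbit_def)

lemma rev_digits_Suc: "rev_digits (Suc k) u = rev_digits k u + rbit k u * 2 ^ k"
  by (simp add: rev_digits_def)

lemma rev_digits_mod: "k \<le> l \<Longrightarrow> rev_digits l u mod 2 ^ k = rev_digits k u"
proof (induction l rule: dec_induct)
  case base
  then show ?case using rev_digits_less by simp
next
  case (step l)
  have "2 ^ k dvd rbit l u * 2 ^ l" using step(1) by (simp add: le_imp_power_dvd)
  then have "rev_digits (Suc l) u mod 2 ^ k = rev_digits l u mod 2 ^ k"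
    unfolding rev_digits_Suc by (metis add.right_neutral dvd_imp_mod_0 mod_add_right_eq)
  then show ?case using step by simp
qed

lemma rev_digits_interval:
  assumes "c < 2 ^ k"
  shows "\<exists>m. {u. 0 \<le> u \<and> u < 1 \<and> rev_digits k u = c} = {real m / 2 ^ k..<real (Suc m) / 2 ^ k}"
  using assms
proof (induction k arbitrary: c)
  case 0
  then show ?case by (intro exI[of _ 0]) (auto simp: rev_digits_def)
next
  case (Suc k)
  define b where "b = c div 2 ^ k"
  have b: "b < 2" using Suc.prems by (simp add: b_def less_mult_imp_div_less)
  obtain m where m: "{u. 0 \<le> u \<and> u < 1 \<and> rev_digits k u = c mod 2 ^ k} = {real m / 2 ^ k..<real (Suc m) / 2 ^ k}"
    using Suc.IH[of "c mod 2 ^ k"] by auto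
  have "rev_digits (Suc k) u = c \<longleftrightarrow> rev_digits k u = c mod 2 ^ k \<and> rbit k u = b" for u
  proof
    assume c: "rev_digits (Suc k) u = c"
    have "c mod 2 ^ k = rev_digits k u" "c div 2 ^ k = rbit k u"
      unfolding c[symmetric] rev_digits_Suc using rev_digits_less[of k u] by simp_all
    then show "rev_digits k u = c mod 2 ^ k \<and> rbit k u = b" by (simp add: b_def)
  next
    assume "rev_digits k u = c mod 2 ^ k \<and> rbit k u = b"
    then show "rev_digits (Suc k) u = c"
      unfolding rev_digits_Suc b_def by (simp add: mod_div_mult_eq)
  qed
  then have "{u. 0 \<le> u \<and> u < 1 \<and> rev_digits (Suc k) u = c} =
      {real m / 2 ^ k..<real (Suc m) / 2 ^ k} \<inter> {u. rbit k u = b}"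
    unfolding m[symmetric] by auto
  also have "\<dots> = {real (2 * m + b) / 2 ^ Suc k..<real (Suc (2 * m + b)) / 2 ^ Suc k}"
  proof (intro equalityI subsetI)
    fix u assume u: "u \<in> {real m / 2 ^ k..<real (Suc m) / 2 ^ k} \<inter> {u. rbit k u = b}"
    define v where "v = 2 ^ Suc k * u"
    have "2 * real m \<le> v" "v < 2 * real m + 2" using u by (auto simp: v_def field_simps)
    then have "\<lfloor>v\<rfloor> = 2 * int m \<or> \<lfloor>v\<rfloor> = 2 * int m + 1" by linarith
    moreover have "nat \<lfloor>v\<rfloor> mod 2 = b" using u by (simp add: rbit_def v_def)
    ultimately have "\<lfloor>v\<rfloor> = 2 * int m + int b" by (auto simp: nat_add_distrib nat_mult_distrib)
    then have "2 * real m + real b \<le> v" "v < 2 * real m + real b + 1" by linarith+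
    then show "u \<in> {real (2 * m + b) / 2 ^ Suc k..<real (Suc (2 * m + b)) / 2 ^ Suc k}"
      by (simp add: v_def field_simps)
  next
    fix u assume u: "u \<in> {real (2 * m + b) / 2 ^ Suc k..<real (Suc (2 * m + b)) / 2 ^ Suc k}"
    define v where "v = 2 ^ Suc k * u"
    have v: "2 * real m + real b \<le> v" "v < 2 * real m + real b + 1"
      using u by (auto simp: v_def field_simps)
    then have "\<lfloor>v\<rfloor> = int (2 * m + b)" by linarith
    then have "nat \<lfloor>v\<rfloor> = 2 * m + b" by (simp only: nat_int)
    then have "rbit k u = b" using b by (simp add: rbit_def v_def)
    moreover have "2 * real m \<le> v" "v < 2 * real m + 2" using v b by auto
    then have "u \<in> {real m / 2 ^ k..<real (Suc m) / 2 ^ k}" by (simp add: v_def field_simps)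
    ultimately show "u \<in> {real m / 2 ^ k..<real (Suc m) / 2 ^ k} \<inter> {u. rbit k u = b}" by simp
  qed
  finally show ?case by blast
qed

definition digit_map :: "real \<Rightarrow> q2" where
  "digit_map u = Q2 (\<lambda>k. of_nat (rev_digits k u))"

lemma rat_norm2_rev_digits:
  assumes "k \<le> m" "k \<le> n"
  shows "rat_norm2 (of_nat (rev_digits m u) - of_nat (rev_digits n u)) \<le> 2 powi (- int k)"
proof -
  have "rev_digits m u mod 2 ^ k = rev_digits n u mod 2 ^ k"
    using assms by (simp add: rev_digits_mod)
  then have "of_nat (rev_digits m u) \<in> q2_coset (of_nat (rev_digits n u)) k"
    by (simp add: of_nat_in_q2_coset)
  then show ?thesis
    unfolding q2_coset_def using norm2_of_rat[of "of_nat (rev_digits m u) - of_nat (rev_digits n u)"]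
    by (simp add: of_rat_diff)
qed

lemma cauchy2_rev_digits: "cauchy2 (\<lambda>k. of_nat (rev_digits k u))"
  unfolding cauchy2_def
proof (intro allI impI)
  fix e :: real assume "e > 0"
  then obtain k where "(1 / 2) ^ k < e" using real_arch_pow_inv[of e "1/2"] by auto
  then have "2 powi (- int k) < e" by (simp add: power_int_minus power_one_over inverse_eq_divide)
  then show "\<exists>k. \<forall>m\<ge>k. \<forall>n\<ge>k. rat_norm2 (of_nat (rev_digits m u) - of_nat (rev_digits n u)) < e"
    by (intro exI[of _ k] allI impI le_less_trans[OF rat_norm2_rev_digits])
qed

lemma digit_map_in_coset: "digit_map u \<in> q2_coset (of_nat (rev_digits k u)) k"
proof -
  let ?X = "\<lambda>m. of_nat (rev_digits m u) - of_nat (rev_digits k u)"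
  have c: "cauchy2 ?X"
    using cauchy2_add[OF cauchy2_rev_digits cauchy2_const, of u "- of_nat (rev_digits k u)"] by simp
  have "digit_map u - of_nat (rev_digits k u) = Q2 ?X"
    by (simp add: digit_map_def of_nat_Q2 Q2_minus cauchy2_rev_digits)
  moreover have "norm2 (Q2 ?X) \<le> 2 powi (- int k)"
    using norm2_Q2[OF c] rat_norm2_rev_digits[of k _ k u]
    by (intro LIMSEQ_le_const2) auto
  ultimately show ?thesis by (simp add: q2_coset_def)
qed

lemma digit_map_Z2: "digit_map u \<in> Z2"
proof -
  have "rev_digits 0 u = 0" by (simp add: rev_digits_def)
  then show ?thesis using digit_map_in_coset[of u 0] by (simp add: Z2_eq_coset)
qed

lemma digit_map_coset_iff:
  assumes "c < 2 ^ k"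
  shows "digit_map u \<in> q2_coset (of_nat c) k \<longleftrightarrow> rev_digits k u = c"
proof
  assume "digit_map u \<in> q2_coset (of_nat c) k"
  then have "q2_coset (of_nat c) k = q2_coset (of_nat (rev_digits k u)) k"
    using q2_coset_eq digit_map_in_coset by metis
  then have "of_nat c \<in> q2_coset (of_nat (rev_digits k u)) k" using q2_coset_self by metis
  then show "rev_digits k u = c"
    using assms rev_digits_less[of k u] by (simp add: of_nat_in_q2_coset)
qed (use digit_map_in_coset in blast)

lemma Z2_diff: "x \<in> Z2 \<Longrightarrow> y \<in> Z2 \<Longrightarrow> x - y \<in> Z2"
  using norm2_ultra_diff[of x y 0] by (simp add: Z2_def)

lemma Z2_add: "x \<in> Z2 \<Longrightarrow> y \<in> Z2 \<Longrightarrow> x + y \<in> Z2"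
  using norm2_ultra[of x y] by (simp add: Z2_def)

lemma infinite_dyadic_fracs: "infinite (dyadic_fracs :: rat set)"
proof
  assume "finite (dyadic_fracs :: rat set)"
  moreover have "range (\<lambda>g::nat. 1 / 2 ^ Suc g :: rat) \<subseteq> dyadic_fracs"
  proof
    fix x :: rat assume "x \<in> range (\<lambda>g::nat. 1 / 2 ^ Suc g)"
    then obtain g :: nat where "x = of_nat 1 / 2 ^ Suc g" by auto
    moreover have "1 < (2::nat) ^ Suc g" by (rule one_less_power) auto
    ultimately show "x \<in> dyadic_fracs" unfolding dyadic_fracs_altdef by blast
  qed
  moreover have "inj (\<lambda>g::nat. 1 / 2 ^ Suc g :: rat)"
    by (auto simp: inj_def field_simps power_inject_exp simp del: power_Suc)
  ultimately show False using finite_imageD[of "\<lambda>g::nat. 1 / 2 ^ Suc g :: rat" UNIV] finite_subset infinite_UNIV_nat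
    by blast
qed

lemma ex_haar_normalized: "\<exists>M. haar_normalized M"
proof -
  define g where "g = from_nat_into (dyadic_fracs :: rat set)"
  have g: "bij_betw g UNIV dyadic_fracs"
    unfolding g_def by (rule bij_betw_from_nat_into) (auto simp: infinite_dyadic_fracs)
  define U where "U x = of_rat (g (nat \<lfloor>x\<rfloor>)) + digit_map (x - of_int \<lfloor>x\<rfloor>)" for x :: real
  define L where "L = restrict_space lborel {0::real..}"
  have spL: "space L = {0..}" by (simp add: L_def space_restrict_space)
  have vim: "\<exists>x\<ge>0. U -` q2_coset c k \<inter> {0..} = {x..<x + 1 / 2 ^ k}" for c k
  proof -
    obtain r where r: "r \<in> dyadic_fracs" "c - of_rat r \<in> Z2"
      and runiq: "\<And>s. s \<in> dyadic_fracs \<Longrightarrow> c - of_rat s \<in> Z2 \<Longrightarrow> s = r"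
      using ex1_fractional_part[of c] by metis
    obtain N where N: "g N = r" using g r(1) by (metis bij_betw_iff_bijections)
    obtain d where d: "d < 2 ^ k" "norm2 (c - of_rat r - of_nat d) \<le> 2 powi (- int k)"
      using r(2) Z2_approx[of "c - of_rat r" k] by (auto simp: Z2_def)
    have dc: "q2_coset (c - of_rat r) k = q2_coset (of_nat d) k"
      using d(2) by (intro q2_coset_eq) (simp add: q2_coset_def)
    obtain m where m: "{u. 0 \<le> u \<and> u < 1 \<and> rev_digits k u = d} = {real m / 2 ^ k..<real (Suc m) / 2 ^ k}"
      using rev_digits_interval[OF d(1)] by blast
    have memU: "U x \<in> q2_coset c k \<longleftrightarrow> nat \<lfloor>x\<rfloor> = N \<and> rev_digits k (x - of_int \<lfloor>x\<rfloor>) = d" for x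
    proof -
      have "nat \<lfloor>x\<rfloor> = N" if "U x \<in> q2_coset c k"
      proof -
        have "U x - c \<in> Z2" using that q2_coset_mono[of 0 k c] by (auto simp: Z2_def q2_coset_def)
        then have "digit_map (x - of_int \<lfloor>x\<rfloor>) - (U x - c) \<in> Z2" using digit_map_Z2 Z2_diff by blast
        then have "c - of_rat (g (nat \<lfloor>x\<rfloor>)) \<in> Z2" by (simp add: U_def)
        moreover have "g (nat \<lfloor>x\<rfloor>) \<in> dyadic_fracs" using g by (auto simp: bij_betw_def)
        ultimately have "g (nat \<lfloor>x\<rfloor>) = g N" using runiq N by blast
        then show ?thesis using g by (auto simp: bij_betw_def inj_on_def)
      qed
      moreover have "U x \<in> q2_coset c k \<longleftrightarrow> rev_digits k (x - of_int \<lfloor>x\<rfloor>) = d" if "nat \<lfloor>x\<rfloor> = N"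
      proof -
        have "U x \<in> q2_coset c k \<longleftrightarrow> digit_map (x - of_int \<lfloor>x\<rfloor>) \<in> q2_coset (c - of_rat r) k"
          using that N by (simp add: U_def q2_coset_def algebra_simps)
        also have "\<dots> \<longleftrightarrow> rev_digits k (x - of_int \<lfloor>x\<rfloor>) = d"
          unfolding dc by (rule digit_map_coset_iff[OF d(1)])
        finally show ?thesis .
      qed
      ultimately show ?thesis by blast
    qed
    define x0 where "x0 = real N + real m / 2 ^ k"
    have iff: "0 \<le> u \<and> u < 1 \<and> rev_digits k u = d \<longleftrightarrow> real m / 2 ^ k \<le> u \<and> u < real m / 2 ^ k + 1 / 2 ^ k" for u
    proof -
      have "u \<in> {u. 0 \<le> u \<and> u < 1 \<and> rev_digits k u = d} \<longleftrightarrow> u \<in> {real m / 2 ^ k..<real (Suc m) / 2 ^ k}"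
        unfolding m ..
      then show ?thesis by (simp add: add_divide_distrib add.commute)
    qed
    have "U -` q2_coset c k \<inter> {0..} = {x0..<x0 + 1 / 2 ^ k}"
    proof (intro equalityI subsetI)
      fix x assume "x \<in> U -` q2_coset c k \<inter> {0..}"
      then have "0 \<le> x" "nat \<lfloor>x\<rfloor> = N" and *: "rev_digits k (x - of_int \<lfloor>x\<rfloor>) = d" by (auto simp: memU)
      then have fl: "of_int \<lfloor>x\<rfloor> = real N" by (metis of_int_of_nat_eq int_nat_eq zero_le_floor)
      have "0 \<le> x - of_int \<lfloor>x\<rfloor> \<and> x - of_int \<lfloor>x\<rfloor> < 1" by linarith
      with iff[of "x - of_int \<lfloor>x\<rfloor>"] * show "x \<in> {x0..<x0 + 1 / 2 ^ k}"
        unfolding fl by (auto simp: x0_def)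
    next
      fix x assume "x \<in> {x0..<x0 + 1 / 2 ^ k}"
      then have *: "0 \<le> x - real N \<and> x - real N < 1 \<and> rev_digits k (x - real N) = d"
        by (subst iff) (auto simp: x0_def)
      then have fl: "\<lfloor>x\<rfloor> = int N" by linarith
      show "x \<in> U -` q2_coset c k \<inter> {0..}" using * fl by (auto simp: memU)
    qed
    moreover have "x0 \<ge> 0" by (simp add: x0_def)
    ultimately show ?thesis by blast
  qed
  have U [measurable]: "U \<in> measurable L borel"
  proof (subst borel_q2, rule measurable_measure_of)
    fix A assume "A \<in> range (\<lambda>(r, k). q2_coset (of_rat r) k)"
    then obtain p where "A = (\<lambda>(r, k). q2_coset (of_rat r) k) p" by (elim imageE)
    then obtain c k where A: "A = q2_coset c k" by (cases p) simp
    obtain x where x: "x \<ge> 0" "U -` A \<inter> {0..} = {x..<x + 1 / 2 ^ k}" using vim A by blast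
    show "U -` A \<inter> space L \<in> sets L"
      unfolding spL x(2) unfolding L_def using x(1) by (subst sets_restrict_space_iff) auto
  qed auto
  define M where "M = distr L borel U"
  have M: "sets M = sets borel" by (simp add: M_def)
  have eM: "emeasure M (q2_coset c k) = ennreal (1 / 2 ^ k)" for c k
  proof -
    obtain x where x: "x \<ge> 0" "U -` q2_coset c k \<inter> {0..} = {x..<x + 1 / 2 ^ k}" using vim by blast
    have "emeasure M (q2_coset c k) = emeasure L {x..<x + 1 / 2 ^ k}"
      unfolding M_def by (subst emeasure_distr[OF U]) (simp_all add: spL x)
    also have "\<dots> = emeasure lborel {x..<x + 1 / 2 ^ k}"
      unfolding L_def using x(1) by (intro emeasure_restrict_space) auto
    also have "\<dots> = ennreal (1 / 2 ^ k)" by simp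
    finally show ?thesis .
  qed
  have "emeasure M ((+) t ` A) = emeasure M A" if A: "A \<in> sets borel" for t A
  proof -
    have mt [measurable]: "(\<lambda>x. x - t) \<in> borel_measurable (borel :: q2 measure)"
      by (intro borel_measurable_continuous_onI continuous_intros)
    have im: "(+) t ` S = (\<lambda>x. x - t) -` S" for S :: "q2 set"
    proof (intro equalityI subsetI)
      fix x assume "x \<in> (\<lambda>x. x - t) -` S"
      then show "x \<in> (+) t ` S" by (intro image_eqI[of _ _ "x - t"]) auto
    qed auto
    have mt': "(\<lambda>x. x - t) \<in> measurable M borel" using mt by (simp add: measurable_cong_sets[OF M refl])
    have sp: "space M = UNIV" by (simp add: M_def)
    have dist: "emeasure (distr M borel (\<lambda>x. x - t)) S = emeasure M ((+) t ` S)" if "S \<in> sets borel" for S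
      using that by (subst emeasure_distr[OF mt']) (simp_all add: im sp)
    have "distr M borel (\<lambda>x. x - t) = M"
      by (rule q2_measure_eqI) (simp_all add: M dist q2_coset_translate eM)
    then show ?thesis using dist[OF A] by simp
  qed
  moreover have "emeasure M Z2 = 1" by (simp add: Z2_eq_coset eM)
  ultimately have "haar_normalized M" using M by (simp add: haar_normalized_def)
  then show ?thesis ..
qed

lemma ex1_haar_normalized: "\<exists>!M. haar_normalized M"
proof -
  have "M = N" if "haar_normalized M" "haar_normalized N" for M N
    using that by (intro q2_measure_eqI) (simp_all add: haar_normalized_coset, simp_all add: haar_normalized_def)
  then show ?thesis using ex_haar_normalized by blast
qed

definition haar2 :: "q2 measure" where
  "haar2 = (THE M. haar_normalized M)"

lemma haar_normalized_haar2: "haar_normalized haar2"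
  unfolding haar2_def by (rule theI'[OF ex1_haar_normalized])

lemma sets_haar2 [measurable_cong, simp]: "sets haar2 = sets borel"
  using haar_normalized_haar2 by (simp add: haar_normalized_def)

lemma space_haar2 [simp]: "space haar2 = UNIV"
  using sets_eq_imp_space_eq[OF sets_haar2] by simp

lemma emeasure_haar2_Z2: "emeasure haar2 Z2 = 1"
  using haar_normalized_haar2 by (simp add: haar_normalized_def)

lemma sigma_finite_haar2: "sigma_finite_measure haar2"
proof
  let ?A = "range (\<lambda>r. q2_coset (of_rat r) 0)"
  have "\<Union>?A = space haar2"
  proof (intro equalityI subsetI)
    fix x :: q2
    obtain r where "norm2 (x - of_rat r) < 1" by (rule q2_rat_dense[of 1 x]) auto
    then have "x \<in> q2_coset (of_rat r) 0" by (simp add: q2_coset_def)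
    then show "x \<in> \<Union>?A" by blast
  qed simp
  moreover have "\<forall>a\<in>?A. emeasure haar2 a \<noteq> \<infinity>"
    by (auto simp: haar_normalized_coset[OF haar_normalized_haar2])
  ultimately show "\<exists>A. countable A \<and> A \<subseteq> sets haar2 \<and> \<Union>A = space haar2 \<and> (\<forall>a\<in>A. emeasure haar2 a \<noteq> \<infinity>)"
    by (intro exI[of _ ?A]) auto
qed

text \<open>
  The type \<open>q2 ^ 'n\<close> carries the product topology but no product measure, hence the
  transport from the function space.
\<close>

definition haar2_vec :: "(q2 ^ 'n::finite) measure" where
  "haar2_vec = distr (Pi\<^sub>M UNIV (\<lambda>_. haar2)) borel vec_lambda"

lemma measurable_vec_lambda_haar2:
  "vec_lambda \<in> measurable (Pi\<^sub>M UNIV (\<lambda>_::'n::finite. haar2)) (borel :: (q2 ^ 'n) measure)"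
proof -
  have "vec_lambda \<in> measurable (borel :: ('n \<Rightarrow> q2) measure) (borel :: (q2 ^ 'n) measure)"
  proof (rule borel_measurableI)
    fix S :: "(q2 ^ 'n) set" assume S: "open S"
    have "open (vec_lambda -` S :: ('n \<Rightarrow> q2) set)"
    proof (subst open_subopen, intro ballI)
      fix f :: "'n \<Rightarrow> q2" assume "f \<in> vec_lambda -` S"
      then have "vec_lambda f \<in> S" by simp
      then obtain A where A: "\<And>i. open (A i)" "\<And>i. f i \<in> A i" "\<And>y. (\<forall>i. y $ i \<in> A i) \<Longrightarrow> y \<in> S"
        using S unfolding open_vec_def by (metis vec_lambda_beta)
      have "open (Pi\<^sub>E UNIV A)" using A(1) by (intro open_PiE) auto
      moreover have "f \<in> Pi\<^sub>E UNIV A" using A(2) by auto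
      moreover have "Pi\<^sub>E UNIV A \<subseteq> vec_lambda -` S" by (auto intro!: A(3) simp: PiE_iff)
      ultimately show "\<exists>T. open T \<and> f \<in> T \<and> T \<subseteq> vec_lambda -` S" by blast
    qed
    then show "vec_lambda -` S \<inter> space borel \<in> sets borel" by simp
  qed
  moreover have "sets (Pi\<^sub>M UNIV (\<lambda>_::'n. haar2)) = sets (borel :: ('n \<Rightarrow> q2) measure)"
    using sets_PiM_cong[OF refl, of UNIV "\<lambda>_::'n. haar2" "\<lambda>_. borel"]
      sets_PiM_equal_borel[where 'a = 'n and 'b = q2] by simp
  ultimately show ?thesis using measurable_cong_sets by blast
qed

lemma emeasure_haar2_vec_Z2: "emeasure haar2_vec {x :: q2 ^ 'n::finite. \<forall>i. x $ i \<in> Z2} = 1"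
proof -
  interpret sigma_finite_measure haar2 by (rule sigma_finite_haar2)
  interpret product_sigma_finite "\<lambda>_::'n. haar2" ..
  have b: "{x :: q2 ^ 'n. \<forall>i. x $ i \<in> Z2} \<in> sets borel"
  proof (rule borel_open)
    have "open (\<Inter>i. (\<lambda>x :: q2 ^ 'n. x $ i) -` Z2)"
      using open_q2_coset[of 0 0] unfolding Z2_eq_coset
      by (intro open_INT ballI open_vimage_vec_nth) auto
    then show "open {x :: q2 ^ 'n. \<forall>i. x $ i \<in> Z2}" by (simp add: vimage_def Inter_eq)
  qed
  have "emeasure haar2_vec {x :: q2 ^ 'n. \<forall>i. x $ i \<in> Z2} = emeasure (Pi\<^sub>M UNIV (\<lambda>_::'n. haar2)) (Pi\<^sub>E UNIV (\<lambda>_. Z2))"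
    unfolding haar2_vec_def
    by (subst emeasure_distr[OF measurable_vec_lambda_haar2 b])
       (auto simp: space_PiM intro!: arg_cong[where f = "emeasure _"])
  also have "\<dots> = (\<Prod>i\<in>(UNIV :: 'n set). emeasure haar2 Z2)"
    by (rule emeasure_PiM) (auto simp: Z2_eq_coset)
  finally show ?thesis by (simp add: emeasure_haar2_Z2)
qed

definition norm2_vec :: "q2 ^ 'n::finite \<Rightarrow> real" where
  "norm2_vec x = Max (range (\<lambda>i. norm2 (x $ i)))"

lemma norm2_vec_less_iff: "norm2_vec x < e \<longleftrightarrow> (\<forall>i. norm2 (x $ i) < e)"
  unfolding norm2_vec_def by (subst Max_less_iff) auto

lemma norm2_vec_le_iff: "norm2_vec x \<le> e \<longleftrightarrow> (\<forall>i. norm2 (x $ i) \<le> e)"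
  unfolding norm2_vec_def by (subst Max_le_iff) auto

text \<open>
  The library metric on \<open>q2 ^ 'n\<close> is the Euclidean combination of the coordinate
  distances, not the maximum; it induces the same topology as the maximum norm.
\<close>

lemma open_iff_norm2_vec:
  "open (S :: (q2 ^ 'n::finite) set) \<longleftrightarrow> (\<forall>x\<in>S. \<exists>e>0. \<forall>y. norm2_vec (y - x) < e \<longrightarrow> y \<in> S)"
proof
  assume S: "open S"
  show "\<forall>x\<in>S. \<exists>e>0. \<forall>y. norm2_vec (y - x) < e \<longrightarrow> y \<in> S"
  proof
    fix x assume "x \<in> S"
    then obtain A where A: "\<And>i. open (A i)" "\<And>i. x $ i \<in> A i" "\<And>y. (\<forall>i. y $ i \<in> A i) \<Longrightarrow> y \<in> S"
      using S unfolding open_vec_def by metis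
    have "\<exists>e>0. \<forall>y. dist y (x $ i) < e \<longrightarrow> y \<in> A i" for i
      using A(1)[of i] A(2)[of i] unfolding open_dist by blast
    then obtain e where e: "\<And>i. e i > 0" "\<And>i y. dist y (x $ i) < e i \<Longrightarrow> y \<in> A i" by metis
    show "\<exists>e>0. \<forall>y. norm2_vec (y - x) < e \<longrightarrow> y \<in> S"
    proof (intro exI[of _ "Min (range e)"] conjI allI impI)
      show "Min (range e) > 0" using e(1) by (subst Min_gr_iff) auto
      fix y assume "norm2_vec (y - x) < Min (range e)"
      then have "norm2 (y $ i - x $ i) < e i" for i
        using Min_le[of "range e" "e i"] by (auto simp: norm2_vec_less_iff intro: less_le_trans)
      then show "y \<in> S" by (intro A(3) allI e(2)) (simp add: dist_q2_def)
    qed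
  qed
next
  assume *: "\<forall>x\<in>S. \<exists>e>0. \<forall>y. norm2_vec (y - x) < e \<longrightarrow> y \<in> S"
  show "open S"
    unfolding open_vec_def
  proof
    fix x assume "x \<in> S"
    then obtain e where e: "e > 0" "\<And>y. norm2_vec (y - x) < e \<Longrightarrow> y \<in> S" using * by metis
    show "\<exists>A. (\<forall>i. open (A i) \<and> x $ i \<in> A i) \<and> (\<forall>y. (\<forall>i. y $ i \<in> A i) \<longrightarrow> y \<in> S)"
      using e by (intro exI[of _ "\<lambda>i. ball (x $ i) e"])
        (auto intro!: e(2) simp: norm2_vec_less_iff dist_q2_def norm2_minus_commute)
  qed
qed

text \<open>
  The fractional part is the unique $r \in I_2$, read as a rational number in $[0,1)$, that
  differs from $t$ by a 2-adic integer, see \<open>ex1_fractional_part\<close>.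
\<close>

definition frac2 :: "q2 \<Rightarrow> rat" where
  "frac2 t = (THE r. r \<in> dyadic_fracs \<and> t - of_rat r \<in> Z2)"

definition chi2 :: "q2 \<Rightarrow> complex" where
  "chi2 t = exp (2 * of_real pi * \<i> * of_rat (frac2 t))"

definition dot2 :: "q2 ^ 'n \<Rightarrow> q2 ^ 'n::finite \<Rightarrow> q2" where
  "dot2 \<xi> x = (\<Sum>\<nu>\<in>UNIV. \<xi> $ \<nu> * x $ \<nu>)"

text \<open>Only used for nonnegative arguments.\<close>

definition Omega :: "real \<Rightarrow> complex" where
  "Omega t = (if t \<le> 1 then 1 else 0)"

definition locally_constant_on :: "'a::topological_space set \<Rightarrow> ('a \<Rightarrow> 'b) \<Rightarrow> bool" where
  "locally_constant_on S f \<longleftrightarrow> (\<forall>x\<in>S. \<exists>U. open U \<and> x \<in> U \<and> f constant_on (U \<inter> S))"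

definition test_functions :: "(q2 ^ 'n::finite \<Rightarrow> complex) set" where
  "test_functions = {\<phi>. locally_constant_on UNIV \<phi> \<and> compact (closure {x. \<phi> x \<noteq> 0})}"

definition lizorkin :: "(q2 ^ 'n::finite \<Rightarrow> complex) set" where
  "lizorkin = {\<phi>\<in>test_functions. (LINT x|haar2_vec. \<phi> x) = 0}"

definition fourier2 :: "(q2 ^ 'n::finite \<Rightarrow> complex) \<Rightarrow> q2 ^ 'n \<Rightarrow> complex" where
  "fourier2 \<phi> \<xi> = (LINT x|haar2_vec. chi2 (dot2 \<xi> x) * \<phi> x)"

definition inv_fourier2 :: "(q2 ^ 'n::finite \<Rightarrow> complex) \<Rightarrow> q2 ^ 'n \<Rightarrow> complex" where
  "inv_fourier2 \<psi> x = (LINT \<xi>|haar2_vec. chi2 (- dot2 x \<xi>) * \<psi> \<xi>)"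

text \<open>
  A symbol is a function on the complement of 0; it is represented by a total function whose
  value at 0 is never used.
\<close>

definition pseudo_diff_op ::
    "(q2 ^ 'n::finite \<Rightarrow> complex) \<Rightarrow> (q2 ^ 'n \<Rightarrow> complex) \<Rightarrow> q2 ^ 'n \<Rightarrow> complex" where
  "pseudo_diff_op \<A> \<phi> = inv_fourier2 (\<lambda>\<xi>. if \<xi> = 0 then 0 else \<A> \<xi> * fourier2 \<phi> \<xi>)"

text \<open>Eigenfunctions of an operator with domain \<open>D\<close>.\<close>

definition eigenfunction_on ::
    "('a \<Rightarrow> complex) set \<Rightarrow> (('a \<Rightarrow> complex) \<Rightarrow> 'a \<Rightarrow> complex) \<Rightarrow> ('a \<Rightarrow> complex) \<Rightarrow> bool" where
  "eigenfunction_on D T f \<longleftrightarrow> f \<in> D \<and> f \<noteq> (\<lambda>_. 0) \<and> (\<exists>c. T f = (\<lambda>x. c * f x))"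

definition kvec :: "'n set \<Rightarrow> q2 ^ 'n::finite" where
  "kvec e = (\<chi> \<nu>. if \<nu> \<in> e then 1 else 0)"

definition Psi0 :: "'n set \<Rightarrow> int \<Rightarrow> q2 ^ 'n \<Rightarrow> q2 ^ 'n::finite \<Rightarrow> complex" where
  "Psi0 e j a x =
     of_real (2 powr (- (real CARD('n) * real_of_int j) / 2))
     * chi2 (inverse 2 * dot2 (kvec e) (2 powi j *s x - a))
     * Omega (norm2_vec (2 powi j *s x - a))"

end

theory Submission
  imports Defs
begin

text \<open>
  Put \<open>b = 2\<^sup>-\<^sup>j a\<close> and \<open>\<kappa> = 2\<^sup>j\<^sup>-\<^sup>1 k\<close>, where \<open>k\<close> is the indicator vector of \<open>e\<close>. The function is a
  multiple of the character \<open>x \<mapsto> \<chi>(\<kappa> \<cdot> x)\<close> restricted to the ball of radius \<open>2\<^sup>j\<close> around \<open>b\<close>. A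
  character integrates to zero over a ball on which it is not constant, so the Fourier transform
  is a multiple of \<open>\<xi> \<mapsto> \<chi>(b \<cdot> \<xi>)\<close> restricted to the dual ball, which has radius \<open>2\<^sup>-\<^sup>j\<close> and centre
  \<open>-\<kappa>\<close>, and misses 0 because \<open>e\<close> is nonempty. On this ball the transform has no zeros, so the
  injectivity of the inverse transform turns the eigenvalue equation into constancy of the symbol
  there.
\<close>

section \<open>The fractional part and the additive character\<close>

lemma frac2_diff_Z2: "t - of_rat (frac2 t) \<in> Z2"
  unfolding frac2_def using theI'[OF ex1_fractional_part[of t]] by blast

lemma frac2_dyadic: "frac2 t \<in> dyadic_fracs"
  unfolding frac2_def using theI'[OF ex1_fractional_part[of t]] by blast

lemma dyadic_frac_cases:
  assumes "r \<in> (dyadic_fracs :: rat set)"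
  obtains c g where "r = of_int c / 2 ^ g"
  using assms unfolding dyadic_fracs_altdef by (auto intro: that[of "int c" for c])

lemma frac2_bounds: "0 \<le> frac2 t" "frac2 t < 1"
proof -
  obtain c g where c: "frac2 t = of_nat c / 2 ^ g" "c < 2 ^ g"
    using frac2_dyadic[of t] unfolding dyadic_fracs_altdef by blast
  then show "0 \<le> frac2 t" by simp
  have "(of_nat c :: rat) < of_nat (2 ^ g)" using c by (simp only: of_nat_less_iff)
  then show "frac2 t < 1" using c by simp
qed

text \<open>The denominator is a power of two, and the norm bound says that this power divides the
  numerator.\<close>

lemma dyadic_rat_Z2_imp_Ints:
  fixes r :: rat
  assumes "r = of_int c / 2 ^ g" "rat_norm2 r \<le> 1"
  shows "r \<in> \<int>"
proof -
  have n: "rat_norm2 (2 ^ g) = 2 powi (- int g)"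
    using norm2_of_rat[of "2 ^ g"]
    by (simp only: power_int_minus power_int_of_nat) (simp add: of_rat_power norm2_power power_one_over inverse_eq_divide)
  have "of_int c = r * 2 ^ g" using assms by simp
  then have "rat_norm2 (of_int c) = rat_norm2 r * 2 powi (- int g)"
    by (simp add: rat_norm2_mult n)
  also have "\<dots> \<le> 2 powi (- int g)"
    using assms(2) by (intro mult_left_le_one_le) auto
  finally have "2 ^ g dvd c" by (simp only: rat_norm2_int_le)
  then obtain l where "c = 2 ^ g * l" by (elim dvdE)
  then show ?thesis using assms by simp
qed

lemma complex_of_rat_eq: "(of_rat r :: complex) = of_real (of_rat r)"
proof -
  obtain a b where "b \<noteq> 0" "r = of_int a / of_int b" by (rule rat_quot)
  then show ?thesis by (simp add: of_rat_divide)
qed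

lemma exp_2pi_i_rat_Ints: "r \<in> \<int> \<Longrightarrow> exp (2 * of_real pi * \<i> * of_rat r) = 1"
  by (elim Ints_cases) (use exp_integer_2pi in \<open>auto simp: mult_ac\<close>)

text \<open>\<open>frac2\<close> is not additive, but its defect \<open>r\<close> is both a dyadic
  rational and a 2-adic integer, hence an ordinary integer, which the exponential does not
  see.\<close>

lemma chi2_add: "chi2 (s + t) = chi2 s * chi2 t"
proof -
  define r where "r = frac2 (s + t) - frac2 s - frac2 t"
  obtain a g where a: "frac2 (s + t) = of_int a / 2 ^ g" by (rule dyadic_frac_cases[OF frac2_dyadic])
  obtain b h where b: "frac2 s = of_int b / 2 ^ h" by (rule dyadic_frac_cases[OF frac2_dyadic])
  obtain c k where c: "frac2 t = of_int c / 2 ^ k" by (rule dyadic_frac_cases[OF frac2_dyadic])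
  have "r = of_int (a * 2 ^ h * 2 ^ k - b * 2 ^ g * 2 ^ k - c * 2 ^ g * 2 ^ h) / 2 ^ (g + h + k)"
    by (simp add: r_def a b c power_add field_simps)
  moreover have "rat_norm2 r \<le> 1"
  proof -
    have "of_rat r = (s - of_rat (frac2 s)) - (s + t - of_rat (frac2 (s + t))) + (t - of_rat (frac2 t))"
      by (simp add: r_def of_rat_diff)
    also have "\<dots> \<in> Z2" by (intro Z2_add Z2_diff frac2_diff_Z2)
    finally show ?thesis by (simp add: Z2_def)
  qed
  ultimately have "r \<in> \<int>" by (rule dyadic_rat_Z2_imp_Ints)
  then have e: "exp (2 * of_real pi * \<i> * of_rat r) = 1" by (rule exp_2pi_i_rat_Ints)
  have "frac2 (s + t) = r + (frac2 s + frac2 t)" by (simp add: r_def)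
  then show ?thesis
    by (simp only: chi2_def of_rat_add distrib_left exp_add e) simp
qed

text \<open>The fractional part lies in [0,1), so a trivial exponential forces it to be 0. Apart
  from \<open>norm_chi2\<close>, the later facts on \<open>chi2\<close> come from additivity and
  this description of the kernel.\<close>

lemma chi2_eq_1_iff: "chi2 t = 1 \<longleftrightarrow> t \<in> Z2"
proof
  assume "chi2 t = 1"
  then obtain n :: int where "Im (2 * of_real pi * \<i> * of_rat (frac2 t)) = real_of_int (2 * n) * pi"
    unfolding chi2_def exp_eq_1 by blast
  then have "(of_rat (frac2 t) :: real) = of_rat (of_int n)"
    by (simp add: complex_of_rat_eq)
  then have "frac2 t = of_int n" by (simp only: of_rat_eq_iff)
  then have "frac2 t = 0" using frac2_bounds[of t] by simp
  then show "t \<in> Z2" using frac2_diff_Z2[of t] by simp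
next
  assume t: "t \<in> Z2"
  obtain a g where a: "frac2 t = of_int a / 2 ^ g" by (rule dyadic_frac_cases[OF frac2_dyadic])
  have "of_rat (frac2 t) \<in> Z2" using Z2_diff[OF t frac2_diff_Z2[of t]] by simp
  then have "frac2 t \<in> \<int>" by (intro dyadic_rat_Z2_imp_Ints[OF a]) (simp add: Z2_def)
  then show "chi2 t = 1" unfolding chi2_def by (rule exp_2pi_i_rat_Ints)
qed

lemma chi2_0 [simp]: "chi2 0 = 1"
  by (simp add: chi2_eq_1_iff Z2_def)

lemma norm_chi2 [simp]: "norm (chi2 t) = 1"
proof -
  have "chi2 t = exp (\<i> * of_real (2 * pi * of_rat (frac2 t)))"
    by (simp add: chi2_def complex_of_rat_eq mult_ac)
  then show ?thesis by (simp only: norm_exp_i_times)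
qed

lemma chi2_nonzero [simp]: "chi2 t \<noteq> 0"
  using norm_chi2[of t] by (metis norm_zero zero_neq_one)

lemma chi2_sum: "chi2 (\<Sum>i\<in>I. f i) = (\<Prod>i\<in>I. chi2 (f i))"
  by (induction I rule: infinite_finite_induct) (simp_all add: chi2_add)

lemma chi2_of_nat_mult: "chi2 (of_nat r * t) = chi2 t ^ r"
  by (induction r) (simp_all add: chi2_add distrib_right)

text \<open>Since \<open>2 ^ N * s\<close> is a 2-adic integer, \<open>chi2 s\<close> is a root of
  unity of order dividing 2^N, and the sum is geometric. This is the orthogonality relation that
  later isolates a small ball.\<close>

lemma chi2_power_sum:
  assumes "norm2 s \<le> 2 ^ N"
  shows "(\<Sum>r<2 ^ N. chi2 (of_nat r * s)) = (if s \<in> Z2 then 2 ^ N else 0)"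
proof (cases "s \<in> Z2")
  case True
  then have "chi2 s = 1" by (simp add: chi2_eq_1_iff)
  then show ?thesis using True by (simp add: chi2_of_nat_mult)
next
  case False
  have "of_nat (2 ^ N) * s \<in> Z2"
    using assms by (simp add: Z2_def norm2_mult norm2_power power_one_over field_simps)
  then have "chi2 s ^ (2 ^ N) = 1"
    unfolding chi2_of_nat_mult[symmetric] by (simp only: chi2_eq_1_iff)
  moreover have "chi2 s \<noteq> 1" using False by (simp add: chi2_eq_1_iff)
  ultimately show ?thesis using False
    by (simp add: chi2_of_nat_mult geometric_sum)
qed

section \<open>The pairing and the balls of the maximum norm\<close>

lemma dot2_add_left: "dot2 (x + y) z = dot2 x z + dot2 y z"
  by (simp add: dot2_def distrib_right sum.distrib)

lemma dot2_add_right: "dot2 z (x + y) = dot2 z x + dot2 z y"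
  by (simp add: dot2_def distrib_left sum.distrib)

lemma dot2_minus_left: "dot2 (- x) z = - dot2 x z"
  by (simp add: dot2_def sum_negf)

lemma dot2_minus_right: "dot2 z (- x) = - dot2 z x"
  by (simp add: dot2_def sum_negf)

lemma dot2_diff_left: "dot2 (x - y) z = dot2 x z - dot2 y z"
  by (simp add: dot2_def left_diff_distrib sum_subtractf)

lemma dot2_diff_right: "dot2 z (x - y) = dot2 z x - dot2 z y"
  by (simp add: dot2_def right_diff_distrib sum_subtractf)

lemma dot2_scale_left: "dot2 (c *s x) z = c * dot2 x z"
  by (simp add: dot2_def sum_distrib_left mult.assoc)

lemma dot2_scale_right: "dot2 z (c *s x) = c * dot2 z x"
  by (simp add: dot2_def sum_distrib_left mult_ac)

lemma dot2_commute: "dot2 x y = dot2 y x"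
  by (simp add: dot2_def mult.commute)

lemma dot2_0_left [simp]: "dot2 0 x = 0"
  by (simp add: dot2_def)

lemma norm2_sum_le:
  assumes "finite I" "\<And>i. i \<in> I \<Longrightarrow> norm2 (f i) \<le> B" "B \<ge> 0"
  shows "norm2 (\<Sum>i\<in>I. f i) \<le> B"
  using assms
proof (induction I rule: finite_induct)
  case (insert i I)
  then show ?case by (auto intro: order_trans[OF norm2_ultra])
qed simp

text \<open>The closed ball of radius 2^m for \<open>norm2_vec\<close>, split into coordinates so
  that membership and volume factor. An integer exponent suffices because nonzero norms are powers
  of two, and \<open>- m\<close> then indexes the dual ball.\<close>

definition vball :: "q2 ^ 'n::finite \<Rightarrow> int \<Rightarrow> (q2 ^ 'n) set" where
  "vball c m = {x. \<forall>i. norm2 (x $ i - c $ i) \<le> 2 powi m}"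

lemma vball_self [simp]: "c \<in> vball c m"
  by (simp add: vball_def)

lemma mem_vball_iff: "x \<in> vball c m \<longleftrightarrow> norm2_vec (x - c) \<le> 2 powi m"
  by (simp add: vball_def norm2_vec_le_iff)

lemma mem_vball_0: "x \<in> vball 0 m \<longleftrightarrow> (\<forall>i. norm2 (x $ i) \<le> 2 powi m)"
  by (simp add: vball_def)

lemma vball_shift: "x - y \<in> vball c m \<longleftrightarrow> x \<in> vball (c + y) m"
  by (simp add: vball_def algebra_simps)

text \<open>By the ultrametric inequality every point of a ball is a centre of it. Hence two balls
  of the same radius are equal or disjoint.\<close>

lemma vball_eq:
  assumes "x \<in> vball c m"
  shows "vball x m = vball c m"
proof -
  have x: "norm2 (x $ i - c $ i) \<le> 2 powi m" "norm2 (c $ i - x $ i) \<le> 2 powi m" for i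
    using assms by (simp_all add: vball_def norm2_minus_commute)
  have "norm2 (y - x $ i) \<le> 2 powi m \<longleftrightarrow> norm2 (y - c $ i) \<le> 2 powi m" for y i
    using x[of i] norm2_ultra_diff[of y "x $ i" "c $ i"] norm2_ultra_diff[of y "c $ i" "x $ i"] by linarith
  then show ?thesis by (simp add: vball_def)
qed

lemma vball_mono: "k \<le> m \<Longrightarrow> vball c k \<subseteq> vball c m"
  using power_int_increasing[of k m "2::real"] by (auto simp: vball_def intro: order_trans)

text \<open>Balls of reciprocal radii are dual: by \<open>chi2_eq_1_iff\<close>, characters with
  frequency in one ball are trivial on the other.\<close>

lemma dot2_vball:
  assumes "\<xi> \<in> vball 0 (- m)" "x \<in> vball 0 m"
  shows "dot2 \<xi> x \<in> Z2"
proof -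
  have "norm2 (\<xi> $ i * x $ i) \<le> 1" for i
  proof -
    have "norm2 (\<xi> $ i) * norm2 (x $ i) \<le> 2 powi (- m) * 2 powi m"
      using assms by (intro mult_mono) (auto simp: mem_vball_0)
    then show ?thesis by (simp add: norm2_mult power_int_minus)
  qed
  then show ?thesis unfolding Z2_def dot2_def by (auto intro!: norm2_sum_le)
qed

text \<open>The bound \<open>M\<close> allows the small ball to be kept inside a prescribed one as
  well.\<close>

lemma power_int_2_less:
  assumes "(e::real) > 0"
  obtains m :: int where "m \<le> M" "2 powi m < e"
proof -
  obtain k where k: "(1 / 2) ^ k < e" using real_arch_pow_inv[OF assms, of "1/2"] by auto
  have "2 powi (min M (- int k)) \<le> (2::real) powi (- int k)"
    by (rule power_int_increasing) auto
  also have "\<dots> < e" using k by (simp add: power_int_minus power_one_over inverse_eq_divide)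
  finally show ?thesis using that[of "min M (- int k)"] by simp
qed

lemma ex_vball_0: obtains m where "x \<in> vball 0 m"
proof -
  obtain g where g: "norm2_vec x < 2 ^ g" using real_arch_pow[of 2 "norm2_vec x"] by auto
  then have "x \<in> vball 0 (int g)" by (simp add: mem_vball_iff)
  then show ?thesis using that by blast
qed

lemma open_vball: "open (vball c m)"
  unfolding open_iff_norm2_vec
proof (intro ballI exI[of _ "2 powi m"] conjI allI impI)
  fix x y assume x: "x \<in> vball c m" and y: "norm2_vec (y - x) < 2 powi m"
  have "y \<in> vball x m" using y by (simp add: mem_vball_iff)
  then show "y \<in> vball c m" using vball_eq[OF x] by simp
qed simp

text \<open>Balls of one radius partition the space, so the complement is a union of open
  balls.\<close>

lemma closed_vball: "closed (vball c m)"
proof -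
  have "- vball c m = (\<Union>x\<in>- vball c m. vball x m)"
  proof (intro equalityI subsetI)
    fix y assume "y \<in> (\<Union>x\<in>- vball c m. vball x m)"
    then obtain x where "x \<notin> vball c m" "y \<in> vball x m" by blast
    then show "y \<in> - vball c m" by (metis ComplI vball_eq vball_self)
  qed (use vball_self in blast)
  then show ?thesis unfolding closed_def using open_vball by (metis open_UN)
qed

lemma open_vball_subset:
  assumes "open S" "x \<in> S"
  obtains m where "m \<le> M" "vball x m \<subseteq> S"
proof -
  obtain e where e: "e > 0" "\<And>y. norm2_vec (y - x) < e \<Longrightarrow> y \<in> S"
    using assms unfolding open_iff_norm2_vec by metis
  obtain m where m: "m \<le> M" "2 powi m < e" by (rule power_int_2_less[OF e(1)])
  then have "vball x m \<subseteq> S" by (auto simp: mem_vball_iff intro: e(2))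
  with m that show ?thesis by blast
qed

lemma norm2_2_powi: "norm2 (2 powi i) = 2 powi (- i)"
  by (simp add: norm2_powi power_int_minus power_int_divide_distrib inverse_eq_divide)

text \<open>This is \<open>Z2_approx\<close> rescaled: multiples of \<open>2 powi (- m)\<close>, an
  element of norm 2^m, represent the cosets of the ball of radius 2^k in the ball of radius
  2^m.\<close>

lemma q2_approx:
  assumes "norm2 t \<le> 2 powi m" "k \<le> m"
  obtains r :: nat where "r < 2 ^ nat (m - k)" "norm2 (t - of_nat r * 2 powi (- m)) \<le> 2 powi k"
proof -
  have "norm2 (2 powi m * t) \<le> 1"
    using assms(1) by (simp add: norm2_mult norm2_2_powi power_int_minus field_simps)
  then obtain r where r: "r < 2 ^ nat (m - k)" "norm2 (2 powi m * t - of_nat r) \<le> 2 powi (- int (nat (m - k)))"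
    using Z2_approx by metis
  have "t - of_nat r * 2 powi (- m) = (2 powi m * t - of_nat r) * 2 powi (- m)"
    by (simp add: power_int_minus field_simps)
  then have "norm2 (t - of_nat r * 2 powi (- m)) \<le> 2 powi (k - m) * 2 powi m"
    using r(2) assms(2) by (simp add: norm2_mult norm2_2_powi mult_right_mono)
  also have "\<dots> = 2 powi k" by (simp flip: power_int_add)
  finally show ?thesis using r that by blast
qed

lemma compact_vball: "compact (vball (c :: q2 ^ 'n::finite) m)"
  unfolding compact_eq_totally_bounded
proof (intro conjI allI impI)
  show "complete (vball c m)" by (simp add: complete_eq_closed closed_vball)
  fix e :: real assume e: "e > 0"
  \<comment> \<open>The library distance on vectors is Euclidean and is bounded by the sum of the
    \<open>CARD('n)\<close> coordinate distances, each of which will be at most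
    \<open>2 powi k\<close>.\<close>
  obtain k where k: "k \<le> m" "2 powi k < e / (1 + real CARD('n))"
    by (rule power_int_2_less[of "e / (1 + real CARD('n))" m]) (use e in auto)
  define f where "f p = (\<chi> i. c $ i + of_nat (p i) * 2 powi (- m))" for p :: "'n \<Rightarrow> nat"
  define P where "P = f ` (Pi\<^sub>E UNIV (\<lambda>_. {..<2 ^ nat (m - k)}))"
  have "finite P" unfolding P_def by (intro finite_imageI finite_PiE) auto
  moreover have "vball c m \<subseteq> (\<Union>x\<in>P. ball x e)"
  proof
    fix x assume x: "x \<in> vball c m"
    have "\<exists>r<2 ^ nat (m - k). norm2 (x $ i - c $ i - of_nat r * 2 powi (- m)) \<le> 2 powi k" for i
      using x k(1) q2_approx[of "x $ i - c $ i" m k] unfolding vball_def by blast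
    then obtain p where p: "\<And>i. p i < 2 ^ nat (m - k)"
      "\<And>i. norm2 (x $ i - c $ i - of_nat (p i) * 2 powi (- m)) \<le> 2 powi k" by metis
    have "dist x (f p) \<le> (\<Sum>i\<in>UNIV. dist (x $ i) (f p $ i))"
      unfolding dist_vec_def by (rule L2_set_le_sum) simp
    also have "\<dots> \<le> (\<Sum>i\<in>(UNIV::'n set). 2 powi k)"
      using p(2) by (intro sum_mono) (simp add: f_def dist_q2_def diff_diff_eq)
    also have "\<dots> < e"
      using k(2) by (simp add: field_simps) (smt (verit) zero_less_power_int)
    finally have "x \<in> ball (f p) e" by (simp add: dist_commute)
    moreover have "f p \<in> P" unfolding P_def using p(1) by auto
    ultimately show "x \<in> (\<Union>x\<in>P. ball x e)" by blast
  qed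
  ultimately show "\<exists>k. finite k \<and> vball c m \<subseteq> (\<Union>x\<in>k. ball x e)" by blast
qed

section \<open>Haar measure of balls and translation invariance\<close>

lemma q2_ball_measurable [measurable]: "{x. norm2 (x - c) \<le> 2 powi m} \<in> sets borel"
proof (rule borel_open, unfold open_dist, intro ballI exI[of _ "2 powi m"] conjI allI impI)
  fix x y assume "x \<in> {x. norm2 (x - c) \<le> 2 powi m}" "dist y x < 2 powi m"
  then show "y \<in> {x. norm2 (x - c) \<le> 2 powi m}"
    using norm2_ultra_diff[of y c x] by (auto simp: dist_q2_def)
qed simp

text \<open>Balls of radius at most 1 are the cosets measured by
  \<open>haar_normalized_coset\<close>. A larger ball splits into two disjoint balls of half the
  radius, so each induction step doubles the measure.\<close>

lemma emeasure_haar2_ball: "emeasure haar2 {x. norm2 (x - c) \<le> 2 powi m} = ennreal (2 powi m)"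
proof (cases "m \<le> 0")
  case True
  then obtain k where m: "m = - int k" by (rule nonpos_int_cases)
  have "1 / 2 ^ k = (2 powi m :: real)"
    by (simp add: m power_int_minus inverse_eq_divide)
  then show ?thesis
    using haar_normalized_coset[OF haar_normalized_haar2, of c k] by (simp add: q2_coset_def m)
next
  case False
  have "emeasure haar2 {x. norm2 (x - c) \<le> 2 powi (int k)} = ennreal (2 ^ k)" for k
  proof (induction k arbitrary: c)
    case 0
    have "{x. norm2 (x - c) \<le> 2 powi 0} = q2_coset c 0" by (simp add: q2_coset_def)
    then show ?case using haar_normalized_coset[OF haar_normalized_haar2, of c 0] by simp
  next
    case (Suc k)
    let ?B = "\<lambda>c k. {x. norm2 (x - c) \<le> 2 powi (int k)}"
    \<comment> \<open>The offset has norm 2^(k+1), so \<open>d\<close> lies in the large ball but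
      farther than 2^k from \<open>c\<close>: it is a centre of the second half.\<close>
    define d where "d = c + inverse (2 ^ Suc k)"
    have n: "norm2 (inverse (2 ^ Suc k)) = 2 ^ Suc k"
      by (simp only: norm2_inverse norm2_power norm2_2) (simp add: power_one_over inverse_eq_divide)
    have "?B c (Suc k) = ?B c k \<union> ?B d k"
    proof (intro equalityI subsetI)
      fix x assume "x \<in> ?B c (Suc k)"
      then have "norm2 (x - c) \<le> 2 powi int (Suc k)" by (simp only: mem_Collect_eq)
      moreover have "int k \<le> int (Suc k)" by simp
      ultimately obtain r where r: "r < 2 ^ nat (int (Suc k) - int k)"
        "norm2 (x - c - of_nat r * 2 powi (- int (Suc k))) \<le> 2 powi int k"
        by (rule q2_approx)
      have e: "2 powi (- int (Suc k)) = (inverse (2 ^ Suc k) :: q2)"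
        unfolding power_int_minus power_int_of_nat ..
      have "r = 0 \<or> r = 1" using r(1) by auto
      then show "x \<in> ?B c k \<union> ?B d k"
        using r(2) unfolding e by (auto simp: d_def diff_diff_eq)
    next
      fix x assume x: "x \<in> ?B c k \<union> ?B d k"
      have "(2::real) ^ k \<le> 2 ^ Suc k" by simp
      moreover have "norm2 (d - c) = 2 ^ Suc k" unfolding d_def add_diff_cancel_left' by (rule n)
      ultimately have "norm2 (x - c) \<le> 2 ^ Suc k"
        using x norm2_ultra_diff[of x c d] by (simp only: Un_iff mem_Collect_eq power_int_of_nat) linarith
      then show "x \<in> ?B c (Suc k)" by (simp only: mem_Collect_eq power_int_of_nat)
    qed
    moreover have "?B c k \<inter> ?B d k = {}"
    proof (rule ccontr)
      assume "?B c k \<inter> ?B d k \<noteq> {}"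
      then obtain x where x: "norm2 (x - c) \<le> 2 ^ k" "norm2 (x - d) \<le> 2 ^ k" by auto
      have "norm2 (d - c) \<le> 2 ^ k"
        using norm2_ultra_diff[of d c x] x norm2_minus_commute[of x d] by linarith
      then have "(2::real) ^ Suc k \<le> 2 ^ k" unfolding d_def add_diff_cancel_left' n .
      then show False by simp
    qed
    ultimately have "emeasure haar2 (?B c (Suc k)) = emeasure haar2 (?B c k) + emeasure haar2 (?B d k)"
      using q2_ball_measurable by (simp only: plus_emeasure sets_haar2)
    also have "\<dots> = ennreal (2 ^ k) + ennreal (2 ^ k)"
      unfolding Suc.IH ..
    also have "\<dots> = ennreal (2 ^ Suc k)"
      by (simp flip: ennreal_plus)
    finally show ?case .
  qed
  from this[of "nat m"] False show ?thesis by (simp add: power_int_def)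
qed

lemma product_sigma_finite_haar2: "product_sigma_finite (\<lambda>_::'n. haar2)"
  by (simp add: product_sigma_finite_def sigma_finite_haar2)

lemma sets_haar2_vec [measurable_cong, simp]: "sets haar2_vec = sets borel"
  by (simp add: haar2_vec_def)

lemma vball_measurable [measurable]: "vball c m \<in> sets borel"
  by (simp add: borel_open open_vball)

lemma emeasure_vball:
  fixes c :: "q2 ^ 'n::finite"
  shows "emeasure haar2_vec (vball c m) = ennreal ((2 powi m) ^ CARD('n))"
proof -
  interpret product_sigma_finite "\<lambda>_::'n. haar2" by (rule product_sigma_finite_haar2)
  have "emeasure haar2_vec (vball c m) =
      emeasure (Pi\<^sub>M UNIV (\<lambda>_::'n. haar2)) (Pi\<^sub>E UNIV (\<lambda>i. {x. norm2 (x - c $ i) \<le> 2 powi m}))"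
    unfolding haar2_vec_def
    by (subst emeasure_distr[OF measurable_vec_lambda_haar2 vball_measurable])
       (auto simp: space_PiM vball_def intro!: arg_cong[where f = "emeasure _"])
  also have "\<dots> = (\<Prod>i\<in>(UNIV :: 'n set). emeasure haar2 {x. norm2 (x - c $ i) \<le> 2 powi m})"
    by (rule emeasure_PiM) (auto intro: q2_ball_measurable)
  also have "\<dots> = ennreal ((2 powi m) ^ CARD('n))"
    by (simp add: emeasure_haar2_ball ennreal_power)
  finally show ?thesis .
qed

lemma measurable_plus_q2_vec: "(+) t \<in> measurable borel (borel :: (q2 ^ 'n::finite) measure)"
proof (rule borel_measurableI)
  fix S :: "(q2 ^ 'n) set" assume S: "open S"
  have "open ((+) t -` S)"
    unfolding open_iff_norm2_vec
  proof
    fix x assume "x \<in> (+) t -` S"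
    then obtain e where e: "e > 0" "\<And>y. norm2_vec (y - (t + x)) < e \<Longrightarrow> y \<in> S"
      using S unfolding open_iff_norm2_vec by (metis vimageE)
    show "\<exists>e>0. \<forall>y. norm2_vec (y - x) < e \<longrightarrow> y \<in> (+) t -` S"
      using e by (intro exI[of _ e]) simp
  qed
  then show "(+) t -` S \<inter> space borel \<in> sets borel" by simp
qed

text \<open>Translation acts coordinatewise, so on the product space it is enough to compare the
  measures of boxes, where each factor is invariant.\<close>

lemma distr_haar2_vec_translate: "distr haar2_vec borel ((+) t) = (haar2_vec :: (q2 ^ 'n::finite) measure)"
proof -
  interpret product_sigma_finite "\<lambda>_::'n. haar2" by (rule product_sigma_finite_haar2)
  let ?P = "Pi\<^sub>M UNIV (\<lambda>_::'n. haar2)"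
  define s where "s f = (\<lambda>i. t $ i + f i)" for f :: "'n \<Rightarrow> q2"
  have t1: "(+) u \<in> measurable haar2 haar2" for u
    by (simp add: measurable_cong_sets[OF sets_haar2 sets_haar2])
  have s [measurable]: "s \<in> measurable ?P ?P"
    unfolding s_def
  proof (rule measurable_PiM_single')
    fix i :: 'n
    have "(\<lambda>f. f i) \<in> measurable ?P haar2" by (rule measurable_component_singleton) simp
    then show "(\<lambda>f. t $ i + f i) \<in> measurable ?P haar2" using t1 by (rule measurable_compose)
  qed auto
  have sP: "distr ?P ?P s = ?P"
  proof (rule PiM_eqI)
    fix A :: "'n \<Rightarrow> q2 set" assume A: "\<And>i. i \<in> UNIV \<Longrightarrow> A i \<in> sets haar2"
    \<comment> \<open>Preimages under a translation are rewritten as images under the opposite one,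
      the form in which \<open>haar_normalized\<close> states invariance.\<close>
    define B where "B i = (+) (- (t $ i)) ` A i" for i
    have B: "B i = (+) (t $ i) -` A i" for i
    proof (intro equalityI subsetI)
      fix x assume "x \<in> (+) (t $ i) -` A i"
      then show "x \<in> B i" unfolding B_def by (intro image_eqI[of _ _ "t $ i + x"]) auto
    qed (auto simp: B_def)
    have BM: "B i \<in> sets haar2" for i
      using measurable_sets[OF t1, of "A i" "t $ i"] A by (simp add: B)
    have "emeasure (distr ?P ?P s) (Pi\<^sub>E UNIV A) = emeasure ?P (s -` Pi\<^sub>E UNIV A \<inter> space ?P)"
      by (rule emeasure_distr[OF s]) (use A in \<open>auto intro!: sets_PiM_I_finite\<close>)
    also have "s -` Pi\<^sub>E UNIV A \<inter> space ?P = Pi\<^sub>E UNIV B"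
      by (auto simp: s_def B space_PiM PiE_iff)
    also have "emeasure ?P (Pi\<^sub>E UNIV B) = (\<Prod>i\<in>UNIV. emeasure haar2 (B i))"
      by (rule emeasure_PiM) (use BM in auto)
    also have "\<dots> = (\<Prod>i\<in>UNIV. emeasure haar2 (A i))"
    proof (rule prod.cong)
      fix i
      have "A i \<in> sets borel" using A[of i] by simp
      then show "emeasure haar2 (B i) = emeasure haar2 (A i)"
        using haar_normalized_haar2 unfolding haar_normalized_def B_def by blast
    qed simp
    finally show "emeasure (distr ?P ?P s) (Pi\<^sub>E UNIV A) = (\<Prod>i\<in>UNIV. emeasure haar2 (A i))" .
  qed simp_all
  have "distr haar2_vec borel ((+) t) = distr ?P borel ((+) t \<circ> vec_lambda)"
    unfolding haar2_vec_def by (rule distr_distr[OF measurable_plus_q2_vec measurable_vec_lambda_haar2])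
  also have "(+) t \<circ> vec_lambda = vec_lambda \<circ> s"
    by (auto simp: s_def vec_eq_iff fun_eq_iff)
  also have "distr ?P borel (vec_lambda \<circ> s) = distr (distr ?P ?P s) borel vec_lambda"
    by (rule distr_distr[OF measurable_vec_lambda_haar2 s, symmetric])
  finally show ?thesis unfolding sP haar2_vec_def .
qed

lemma integral_haar2_vec_translate:
  fixes f :: "q2 ^ 'n::finite \<Rightarrow> complex"
  assumes "f \<in> borel_measurable borel"
  shows "(LINT x|haar2_vec. f (t + x)) = (LINT x|haar2_vec. f x)"
proof -
  have mt: "(+) t \<in> measurable haar2_vec (borel :: (q2 ^ 'n) measure)"
    by (simp add: measurable_cong_sets[OF sets_haar2_vec refl] measurable_plus_q2_vec)
  have "(LINT x|distr haar2_vec borel ((+) t). f x) = (LINT x|haar2_vec. f (t + x))"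
    by (rule integral_distr[OF mt assms])
  then show ?thesis by (simp add: distr_haar2_vec_translate)
qed

section \<open>Locally constant functions and integrals of characters over balls\<close>

lemma locally_constant_on_imp_continuous_on:
  fixes f :: "'a::topological_space \<Rightarrow> 'b::topological_space"
  assumes "locally_constant_on S f"
  shows "continuous_on S f"
  unfolding continuous_on_topological
proof (intro ballI allI impI)
  fix x B assume x: "x \<in> S" and B: "open B" "f x \<in> B"
  obtain U where U: "open U" "x \<in> U" "f constant_on (U \<inter> S)"
    using assms x unfolding locally_constant_on_def by blast
  then have "f y = f x" if "y \<in> S" "y \<in> U" for y
    using that x unfolding constant_on_def by (metis IntI)
  then show "\<exists>A. open A \<and> x \<in> A \<and> (\<forall>y\<in>S. y \<in> A \<longrightarrow> f y \<in> B)" using U B by metis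
qed

lemma locally_constant_on_UNIV_I:
  assumes "\<And>x. \<exists>m. \<forall>y\<in>vball x m. f y = f x"
  shows "locally_constant_on UNIV f"
  unfolding locally_constant_on_def
proof
  fix x
  obtain m where "\<forall>y\<in>vball x m. f y = f x" using assms by blast
  then show "\<exists>U. open U \<and> x \<in> U \<and> f constant_on U \<inter> UNIV"
    by (intro exI[of _ "vball x m"] conjI open_vball vball_self)
       (unfold constant_on_def, blast)
qed

text \<open>The radius is uniform in \<open>x\<close>: it suffices that increments lie in the dual
  of a ball containing \<open>\<xi>\<close>.\<close>

lemma chi2_dot2_locally_constant:
  obtains m where "m \<le> M" "\<And>x y. y \<in> vball x m \<Longrightarrow> chi2 (dot2 \<xi> y) = chi2 (dot2 \<xi> x)"
proof -
  obtain m where m: "\<xi> \<in> vball 0 m" by (rule ex_vball_0)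
  define k where "k = min M (- m)"
  have "chi2 (dot2 \<xi> y) = chi2 (dot2 \<xi> x)" if "y \<in> vball x k" for x y
  proof -
    have "y - x \<in> vball 0 (- m)"
      using that vball_mono[of k "- m" x] by (auto simp: vball_shift k_def)
    then have "chi2 (dot2 \<xi> (y - x)) = 1" using m by (simp only: chi2_eq_1_iff) (rule dot2_vball[of _ "- m"], simp_all)
    then show ?thesis using chi2_add[of "dot2 \<xi> x" "dot2 \<xi> (y - x)"] by (simp flip: dot2_add_right)
  qed
  moreover have "k \<le> M" by (simp add: k_def)
  ultimately show ?thesis using that by blast
qed

lemma chi2_dot2_measurable [measurable]: "(\<lambda>x. chi2 (dot2 \<xi> x)) \<in> borel_measurable borel"
proof -
  have "locally_constant_on UNIV (\<lambda>x. chi2 (dot2 \<xi> x))"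
    by (rule locally_constant_on_UNIV_I) (metis chi2_dot2_locally_constant)
  then show ?thesis
    by (intro borel_measurable_continuous_onI locally_constant_on_imp_continuous_on)
qed

text \<open>Translating the ball by \<open>t\<close> multiplies the integral by
  \<open>chi2 (dot2 \<xi> t)\<close>. If the character is trivial on the ball around 0, the integral
  there is the volume. Otherwise some \<open>t\<close> preserves the ball while the factor differs
  from 1, so the integral vanishes.\<close>

lemma integral_chi2_vball:
  fixes \<xi> c :: "q2 ^ 'n::finite"
  shows "(LINT x|haar2_vec. chi2 (dot2 \<xi> x) * indicator (vball c m) x) =
    (if \<xi> \<in> vball 0 (- m) then of_real ((2 powi m) ^ CARD('n)) * chi2 (dot2 \<xi> c) else 0)"
proof -
  let ?f = "\<lambda>c x. chi2 (dot2 \<xi> x) * indicator (vball c m) x :: complex"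
  have shift: "(LINT x|haar2_vec. ?f (t + c) x) = chi2 (dot2 \<xi> t) * (LINT x|haar2_vec. ?f c x)" for t c
  proof -
    have "(LINT x|haar2_vec. ?f (t + c) x) = (LINT x|haar2_vec. ?f (t + c) (t + x))"
      by (rule integral_haar2_vec_translate[symmetric]) measurable
    also have "(\<lambda>x. ?f (t + c) (t + x)) = (\<lambda>x. chi2 (dot2 \<xi> t) * ?f c x)"
      by (auto simp: fun_eq_iff dot2_add_right chi2_add indicator_def vball_def)
    finally show ?thesis by simp
  qed
  show ?thesis
  proof (cases "\<xi> \<in> vball 0 (- m)")
    case True
    have "?f 0 = (\<lambda>x. of_real (indicator (vball 0 m) x))"
      using dot2_vball[OF True] by (auto simp: fun_eq_iff indicator_def chi2_eq_1_iff)
    then have "(LINT x|haar2_vec. ?f 0 x) = of_real (measure haar2_vec (vball (0 :: q2 ^ 'n) m))"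
      by (simp only: integral_complex_of_real integral_indicator) simp
    also have "measure haar2_vec (vball (0 :: q2 ^ 'n) m) = (2 powi m) ^ CARD('n)"
      by (simp add: measure_def emeasure_vball)
    finally have "(LINT x|haar2_vec. ?f 0 x) = of_real ((2 powi m) ^ CARD('n))" .
    then show ?thesis using shift[of c 0] True by simp
  next
    case False
    then obtain i where i: "norm2 (\<xi> $ i) > 2 powi (- m)" by (auto simp: mem_vball_0 not_le)
    \<comment> \<open>\<open>2 powi (- m)\<close> has norm 2^m, the largest shift along coordinate
      \<open>i\<close> that preserves the ball; this makes the norm of \<open>dot2 \<xi> t\<close>
      exceed 1.\<close>
    define t :: "q2 ^ 'n" where "t = axis i (2 powi (- m))"
    have n: "norm2 (2 powi (- m)) = 2 powi m"
      by (simp only: norm2_2_powi minus_minus)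
    have "dot2 \<xi> t = \<xi> $ i * 2 powi (- m)"
      by (simp add: dot2_def t_def axis_def if_distrib cong: if_cong)
    then have "norm2 (dot2 \<xi> t) > 2 powi (- m) * 2 powi m"
      using i by (simp only: norm2_mult n) simp
    then have "dot2 \<xi> t \<notin> Z2" by (simp add: Z2_def power_int_minus)
    then have ne: "chi2 (dot2 \<xi> t) \<noteq> 1" by (simp add: chi2_eq_1_iff)
    have "c \<in> vball (t + c) m" by (auto simp: vball_def t_def axis_def n)
    then have "vball (t + c) m = vball c m" using vball_eq by metis
    then have "(LINT x|haar2_vec. ?f c x) = chi2 (dot2 \<xi> t) * (LINT x|haar2_vec. ?f c x)"
      using shift[of t c] by simp
    then show ?thesis using ne False by simp
  qed
qed

section \<open>Integrability and injectivity of the inverse Fourier transform\<close>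

text \<open>Compactness bounds \<open>f\<close> on the ball. This makes a symbol, which may be
  unbounded near 0 or at infinity, integrable over a ball that avoids 0.\<close>

lemma integrable_continuous_vball:
  fixes f :: "q2 ^ 'n::finite \<Rightarrow> complex"
  assumes "continuous_on (vball c m) f"
  shows "integrable haar2_vec (\<lambda>x. indicator (vball c m) x *\<^sub>R f x)"
proof -
  have "bounded (f ` vball c m)"
    by (intro compact_imp_bounded compact_continuous_image assms compact_vball)
  then obtain B where B: "\<And>x. x \<in> vball c m \<Longrightarrow> norm (f x) \<le> B"
    unfolding bounded_iff by blast
  show ?thesis
  proof (rule integrableI_bounded_set[where A = "vball c m" and B = B])
    show "(\<lambda>x. indicator (vball c m) x *\<^sub>R f x) \<in> borel_measurable haar2_vec"
      using borel_measurable_continuous_on_indicator[OF vball_measurable assms]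
      by (simp add: measurable_cong_sets[OF sets_haar2_vec refl])
  qed (use B in \<open>auto simp: emeasure_vball\<close>)
qed

lemma integrable_chi2_mult:
  assumes "integrable haar2_vec G"
  shows "integrable haar2_vec (\<lambda>\<xi>. chi2 (- dot2 x \<xi>) * G \<xi>)"
proof (rule Bochner_Integration.integrable_bound[OF assms])
  have "(\<lambda>\<xi>. chi2 (- dot2 x \<xi>)) \<in> borel_measurable haar2_vec"
    using chi2_dot2_measurable[of "- x"]
    by (simp add: dot2_minus_left measurable_cong_sets[OF sets_haar2_vec refl])
  then show "(\<lambda>\<xi>. chi2 (- dot2 x \<xi>) * G \<xi>) \<in> borel_measurable haar2_vec"
    using assms by (intro borel_measurable_times) auto
qed (simp add: norm_mult)

text \<open>
  On \<open>vball d M\<close> the indicator of the small ball \<open>vball \<xi>0 k\<close> is an average of finitely many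
  characters, so the vanishing of the inverse transform localizes to the small ball.
\<close>

lemma inv_fourier2_eq_0_imp:
  fixes G :: "q2 ^ 'n::finite \<Rightarrow> complex"
  assumes int: "integrable haar2_vec G"
    and supp: "\<And>\<xi>. \<xi> \<notin> vball d M \<Longrightarrow> G \<xi> = 0"
    and zero: "\<And>x. inv_fourier2 G x = 0"
    and \<xi>0: "\<xi>0 \<in> vball d M" and k: "k \<le> M"
    and const: "\<And>\<xi>. \<xi> \<in> vball \<xi>0 k \<Longrightarrow> G \<xi> = G \<xi>0"
  shows "G \<xi>0 = 0"
proof -
  \<comment> \<open>The points \<open>f p\<close> represent the ball of radius 2^(-k) modulo the
    ball of radius 2^(-M), so they give all characters of \<open>vball 0 M\<close> that are trivial
    on \<open>vball 0 k\<close>. The sign in \<open>f\<close> makes the exponents in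
    \<open>avg\<close> sums of the terms \<open>of_nat (p i) * s i\<close>.\<close>
  define N where "N = nat (M - k)"
  define P where "P = Pi\<^sub>E (UNIV :: 'n set) (\<lambda>_. {..<2 ^ N :: nat})"
  define f :: "('n \<Rightarrow> nat) \<Rightarrow> q2 ^ 'n" where "f p = (\<chi> i. - (of_nat (p i) * 2 powi k))" for p
  have D: "vball \<xi>0 M = vball d M" by (rule vball_eq[OF \<xi>0])
  have avg: "(\<Sum>p\<in>P. chi2 (dot2 (f p) \<xi>0) * chi2 (- dot2 (f p) \<xi>)) =
      (if \<xi> \<in> vball \<xi>0 k then (2 ^ N) ^ CARD('n) else 0)" if "\<xi> \<in> vball d M" for \<xi>
  proof -
    define s where "s i = 2 powi k * (\<xi> $ i - \<xi>0 $ i)" for i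
    have s: "norm2 (s i) = 2 powi (- k) * norm2 (\<xi> $ i - \<xi>0 $ i)" for i
      by (simp only: s_def norm2_mult norm2_2_powi)
    have sN: "norm2 (s i) \<le> 2 ^ N" for i
    proof -
      have "norm2 (s i) \<le> 2 powi (- k) * 2 powi M"
        using that unfolding s D[symmetric] by (intro mult_left_mono) (auto simp: vball_def)
      also have "\<dots> = 2 powi (M - k)" by (simp flip: power_int_add)
      also have "\<dots> = 2 ^ N" using k by (simp add: N_def power_int_def)
      finally show ?thesis .
    qed
    have sZ: "s i \<in> Z2 \<longleftrightarrow> norm2 (\<xi> $ i - \<xi>0 $ i) \<le> 2 powi k" for i
      unfolding Z2_def by (simp add: s power_int_minus field_simps)
    have "chi2 (dot2 (f p) \<xi>0) * chi2 (- dot2 (f p) \<xi>) = (\<Prod>i\<in>UNIV. chi2 (of_nat (p i) * s i))" for p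
      unfolding chi2_add[symmetric] chi2_sum[symmetric]
      by (rule arg_cong[where f = chi2])
         (simp add: dot2_def f_def s_def sum_negf sum_subtractf[symmetric] algebra_simps)
    then have "(\<Sum>p\<in>P. chi2 (dot2 (f p) \<xi>0) * chi2 (- dot2 (f p) \<xi>)) =
        (\<Sum>p\<in>P. \<Prod>i\<in>UNIV. chi2 (of_nat (p i) * s i))" by simp
    also have "\<dots> = (\<Prod>i\<in>UNIV. \<Sum>r<2 ^ N. chi2 (of_nat r * s i))"
      unfolding P_def by (rule prod_sum_PiE[symmetric]) auto
    also have "\<dots> = (\<Prod>i\<in>(UNIV :: 'n set). if s i \<in> Z2 then 2 ^ N else 0)"
      by (simp only: chi2_power_sum[OF sN])
    also have "\<dots> = (if \<xi> \<in> vball \<xi>0 k then (2 ^ N) ^ CARD('n) else 0)"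
      by (auto simp: vball_def sZ)
    finally show ?thesis .
  qed
  have eq: "(\<Sum>p\<in>P. chi2 (dot2 (f p) \<xi>0) * (chi2 (- dot2 (f p) \<xi>) * G \<xi>)) =
      (2 ^ N) ^ CARD('n) * G \<xi>0 * of_real (indicator (vball \<xi>0 k) \<xi>)" for \<xi>
  proof (cases "\<xi> \<in> vball d M")
    case True
    have "(\<Sum>p\<in>P. chi2 (dot2 (f p) \<xi>0) * (chi2 (- dot2 (f p) \<xi>) * G \<xi>)) =
        (\<Sum>p\<in>P. chi2 (dot2 (f p) \<xi>0) * chi2 (- dot2 (f p) \<xi>)) * G \<xi>"
      by (simp only: sum_distrib_right mult.assoc)
    then show ?thesis unfolding avg[OF True] using const[of \<xi>] by simp
  next
    case False
    then have "\<xi> \<notin> vball \<xi>0 k" using vball_mono[OF k, of \<xi>0] D by blast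
    then show ?thesis using supp[OF False] by simp
  qed
  \<comment> \<open>Termwise integration gives \<open>inv_fourier2 G (f p)\<close> up to a constant
    factor, and this is 0 by \<open>zero\<close>. The left side is \<open>G \<xi>0\<close> times a
    positive constant.\<close>
  have "(LINT \<xi>|haar2_vec. (2 ^ N) ^ CARD('n) * G \<xi>0 * of_real (indicator (vball \<xi>0 k) \<xi>)) =
      (\<Sum>p\<in>P. LINT \<xi>|haar2_vec. chi2 (dot2 (f p) \<xi>0) * (chi2 (- dot2 (f p) \<xi>) * G \<xi>))"
    unfolding eq[symmetric]
    by (intro Bochner_Integration.integral_sum integrable_mult_right integrable_chi2_mult int)
  also have "\<dots> = 0"
    using zero by (simp add: inv_fourier2_def)
  finally have "(2 ^ N) ^ CARD('n) * G \<xi>0 * of_real (measure haar2_vec (vball \<xi>0 k)) = 0"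
    by (simp only: integral_mult_right_zero integral_complex_of_real integral_indicator) simp
  moreover have "measure haar2_vec (vball \<xi>0 k) = (2 powi k) ^ CARD('n)"
    by (simp add: measure_def emeasure_vball)
  ultimately show ?thesis by simp
qed

section \<open>The wavelet and its Fourier transform\<close>

lemma norm2_vec_affine_le_1_iff:
  "norm2_vec (2 powi j *s x - a) \<le> 1 \<longleftrightarrow> x \<in> vball (2 powi (- j) *s a) j"
proof -
  have "norm2 (2 powi j * x $ i - a $ i) \<le> 1 \<longleftrightarrow> norm2 (x $ i - 2 powi (- j) * a $ i) \<le> 2 powi j" for i
  proof -
    have "2 powi j * x $ i - a $ i = 2 powi j * (x $ i - 2 powi (- j) * a $ i)"
      by (simp add: power_int_minus field_simps)
    then have "norm2 (2 powi j * x $ i - a $ i) = 2 powi (- j) * norm2 (x $ i - 2 powi (- j) * a $ i)"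
      by (simp only: norm2_mult norm2_2_powi)
    moreover have "2 powi (- j) * norm2 u \<le> 1 \<longleftrightarrow> norm2 u \<le> 2 powi j" for u
      by (simp add: power_int_minus field_simps)
    ultimately show ?thesis by simp
  qed
  then show ?thesis by (simp add: norm2_vec_le_iff vball_def)
qed

definition wave_freq :: "'n set \<Rightarrow> int \<Rightarrow> q2 ^ 'n::finite" where
  "wave_freq e j = 2 powi (j - 1) *s kvec e"

text \<open>The phase is inverse to the value of the character at the centre of the ball, so
  \<open>Psi0\<close> takes the value 2^(-nj/2) there, with n the dimension.\<close>

definition wave_coeff :: "'n set \<Rightarrow> int \<Rightarrow> q2 ^ 'n::finite \<Rightarrow> complex" where
  "wave_coeff e j a = of_real (2 powr (- (real CARD('n) * real_of_int j) / 2))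
     * chi2 (- dot2 (wave_freq e j) (2 powi (- j) *s a))"

lemma wave_coeff_nonzero [simp]: "wave_coeff e j a \<noteq> 0"
  by (simp add: wave_coeff_def)

lemma Psi0_eq:
  "Psi0 e j a x = wave_coeff e j a *
     (chi2 (dot2 (wave_freq e j) x) * indicator (vball (2 powi (- j) *s a) j) x)"
proof -
  have h: "2 powi (j - 1) = (inverse 2 * 2 powi j :: q2)"
    by (simp add: power_int_diff inverse_eq_divide)
  have "inverse 2 * dot2 (kvec e) (2 powi j *s x - a) =
      - dot2 (wave_freq e j) (2 powi (- j) *s a) + dot2 (wave_freq e j) x"
    by (simp add: wave_freq_def h dot2_diff_right dot2_scale_left dot2_scale_right
        power_int_minus algebra_simps)
  then have "chi2 (inverse 2 * dot2 (kvec e) (2 powi j *s x - a)) =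
      chi2 (- dot2 (wave_freq e j) (2 powi (- j) *s a)) * chi2 (dot2 (wave_freq e j) x)"
    by (simp only: chi2_add)
  then show ?thesis
    by (simp add: Psi0_def wave_coeff_def Omega_def norm2_vec_affine_le_1_iff indicator_def)
qed

text \<open>The Fourier kernel shifts the frequency of the wavelet to
  \<open>\<xi> + wave_freq e j\<close>, after which \<open>integral_chi2_vball\<close>
  applies.\<close>

lemma fourier2_Psi0:
  fixes a :: "q2 ^ 'n::finite"
  shows "fourier2 (Psi0 e j a) \<xi> =
    wave_coeff e j a * of_real ((2 powi j) ^ CARD('n)) * chi2 (dot2 (wave_freq e j) (2 powi (- j) *s a))
      * (chi2 (dot2 (2 powi (- j) *s a) \<xi>) * indicator (vball (- wave_freq e j) (- j)) \<xi>)"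
proof -
  have "fourier2 (Psi0 e j a) \<xi> = (LINT x|haar2_vec. wave_coeff e j a *
      (chi2 (dot2 (\<xi> + wave_freq e j) x) * indicator (vball (2 powi (- j) *s a) j) x))"
    unfolding fourier2_def Psi0_eq
    by (rule Bochner_Integration.integral_cong) (simp_all add: dot2_add_left chi2_add mult_ac)
  also have "\<dots> = wave_coeff e j a *
      (LINT x|haar2_vec. chi2 (dot2 (\<xi> + wave_freq e j) x) * indicator (vball (2 powi (- j) *s a) j) x)"
    by simp
  also have "\<dots> = wave_coeff e j a * (if \<xi> + wave_freq e j \<in> vball 0 (- j)
      then of_real ((2 powi j) ^ CARD('n)) * chi2 (dot2 (\<xi> + wave_freq e j) (2 powi (- j) *s a)) else 0)"
    by (simp only: integral_chi2_vball)
  also have "\<xi> + wave_freq e j \<in> vball 0 (- j) \<longleftrightarrow> \<xi> \<in> vball (- wave_freq e j) (- j)"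
    using vball_shift[of \<xi> "- wave_freq e j" 0 "- j"] by simp
  finally show ?thesis
    by (simp add: dot2_add_left chi2_add dot2_commute[of \<xi>] mult_ac)
qed

text \<open>Inversion is checked directly: the transform is again a multiple of a character on a
  ball, so \<open>integral_chi2_vball\<close> applies a second time, and the volumes 2^(jn) and
  2^(-jn) cancel.\<close>

lemma inv_fourier2_fourier2_Psi0:
  fixes a :: "q2 ^ 'n::finite"
  shows "inv_fourier2 (\<lambda>\<xi>. c * fourier2 (Psi0 e j a) \<xi>) x = c * Psi0 e j a x"
proof -
  let ?b = "2 powi (- j) *s a" and ?\<kappa> = "wave_freq e j"
  define D where "D = c * (wave_coeff e j a * of_real ((2 powi j) ^ CARD('n)) * chi2 (dot2 ?\<kappa> ?b))"
  have "inv_fourier2 (\<lambda>\<xi>. c * fourier2 (Psi0 e j a) \<xi>) x =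
      (LINT \<xi>|haar2_vec. D * (chi2 (dot2 (?b - x) \<xi>) * indicator (vball (- ?\<kappa>) (- j)) \<xi>))"
    unfolding inv_fourier2_def fourier2_Psi0
    by (rule Bochner_Integration.integral_cong)
       (simp_all add: D_def diff_conv_add_uminus dot2_add_left dot2_minus_left chi2_add mult_ac del: add_uminus_conv_diff)
  also have "\<dots> = D * (if ?b - x \<in> vball 0 j
      then of_real ((2 powi (- j)) ^ CARD('n)) * chi2 (dot2 (?b - x) (- ?\<kappa>)) else 0)"
    by (simp only: integral_mult_right_zero integral_chi2_vball minus_minus)
  also have "dot2 (?b - x) (- ?\<kappa>) = dot2 ?\<kappa> x - dot2 ?\<kappa> ?b"
    by (simp only: dot2_minus_right dot2_diff_left dot2_diff_right dot2_commute[of _ ?\<kappa>] minus_diff_eq)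
  also have "?b - x \<in> vball 0 j \<longleftrightarrow> x \<in> vball ?b j"
    by (simp add: vball_def norm2_minus_commute)
  also have "D * (if x \<in> vball ?b j
      then of_real ((2 powi (- j)) ^ CARD('n)) * chi2 (dot2 ?\<kappa> x - dot2 ?\<kappa> ?b) else 0) = c * Psi0 e j a x"
  proof -
    have "(2 powi j) ^ CARD('n) * (2 powi (- j)) ^ CARD('n) = (1 :: real)"
      by (simp flip: power_mult_distrib power_int_add)
    then have "of_real ((2 powi j) ^ CARD('n)) * of_real ((2 powi (- j)) ^ CARD('n)) = (1 :: complex)"
      by (simp only: of_real_mult[symmetric] of_real_1)
    moreover have "chi2 (dot2 ?\<kappa> ?b) * chi2 (dot2 ?\<kappa> x - dot2 ?\<kappa> ?b) = chi2 (dot2 ?\<kappa> x)"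
      by (simp flip: chi2_add)
    moreover have "c * (w * u * z) * (u' * z') = c * (w * ((u * u') * (z * z')))" for w u z u' z' :: complex
      by (simp only: mult_ac)
    ultimately show ?thesis
      unfolding Psi0_eq D_def indicator_def
      by (cases "x \<in> vball ?b j")
         (simp_all only: if_True if_False of_bool_eq mult_zero_right mult_1 mult_1_right simp_thms)
  qed
  finally show ?thesis .
qed

text \<open>A coordinate of the centre with index in \<open>e\<close> has norm 2^(1-j), which
  exceeds the radius 2^(-j).\<close>

lemma zero_notin_freq_vball:
  assumes "e \<noteq> {}"
  shows "0 \<notin> vball (- wave_freq e j) (- j)"
proof -
  obtain i where i: "i \<in> e" using assms by blast
  have "norm2 (2 powi (j - 1)) = 2 powi (1 - j)" by (simp add: norm2_2_powi)
  moreover have "2 powi (- j) < (2 powi (1 - j) :: real)"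
    by (rule power_int_strict_increasing) auto
  ultimately show ?thesis
    using i by (auto simp: vball_def wave_freq_def kvec_def not_le intro!: exI[of _ i])
qed

lemma Psi0_lizorkin:
  assumes "e \<noteq> {}"
  shows "Psi0 e j a \<in> lizorkin"
proof -
  let ?b = "2 powi (- j) *s a"
  have "locally_constant_on UNIV (Psi0 e j a)"
  proof (rule locally_constant_on_UNIV_I)
    fix x
    \<comment> \<open>The bound \<open>m \<le> j\<close> puts \<open>vball x m\<close> either inside
      the support ball or outside it, so the indicator is constant there too.\<close>
    obtain m where m: "m \<le> j" "\<And>x y. y \<in> vball x m \<Longrightarrow>
        chi2 (dot2 (wave_freq e j) y) = chi2 (dot2 (wave_freq e j) x)"
      by (rule chi2_dot2_locally_constant) blast
    have "Psi0 e j a y = Psi0 e j a x" if y: "y \<in> vball x m" for y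
    proof -
      have "y \<in> vball x j" using y vball_mono[OF m(1)] by blast
      then have "y \<in> vball ?b j \<longleftrightarrow> x \<in> vball ?b j"
        using vball_eq vball_self by metis
      then show ?thesis using m(2)[OF y] by (simp add: Psi0_eq indicator_def)
    qed
    then show "\<exists>m. \<forall>y\<in>vball x m. Psi0 e j a y = Psi0 e j a x" by blast
  qed
  moreover have "compact (closure {x. Psi0 e j a x \<noteq> 0})"
  proof -
    have "closure {x. Psi0 e j a x \<noteq> 0} \<subseteq> vball ?b j"
      by (rule closure_minimal[OF _ closed_vball]) (auto simp: Psi0_eq indicator_def)
    then have "closure {x. Psi0 e j a x \<noteq> 0} = vball ?b j \<inter> closure {x. Psi0 e j a x \<noteq> 0}" by blast
    then show ?thesis using compact_Int_closed[OF compact_vball closed_closure] by metis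
  qed
  \<comment> \<open>The integral is the Fourier transform at 0, a point outside the frequency
    ball.\<close>
  moreover have "(LINT x|haar2_vec. Psi0 e j a x) = 0"
    using fourier2_Psi0[of e j a 0] zero_notin_freq_vball[OF assms, of j]
    by (simp add: fourier2_def)
  ultimately show ?thesis by (simp add: lizorkin_def test_functions_def)
qed

section \<open>The eigenvalue equation\<close>

lemma pseudo_diff_op_Psi0:
  assumes "e \<noteq> {}"
  shows "pseudo_diff_op \<A> (Psi0 e j a) = inv_fourier2 (\<lambda>\<xi>. \<A> \<xi> * fourier2 (Psi0 e j a) \<xi>)"
  \<comment> \<open>The transform vanishes at 0, so the separate value there changes
    nothing.\<close>
  unfolding pseudo_diff_op_def
  using zero_notin_freq_vball[OF assms, of j]
  by (intro arg_cong[where f = inv_fourier2] ext) (simp add: fourier2_Psi0)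

text \<open>The function \<open>G\<close>, the transform times the symbol minus \<open>c\<close>, is
  supported in the frequency ball and has zero inverse transform. So it vanishes at
  \<open>\<xi>0\<close>, where the transform itself is nonzero.\<close>

lemma eigenfunction_Psi0_imp_constant:
  fixes \<A> :: "q2 ^ 'n::finite \<Rightarrow> complex"
  assumes lc: "locally_constant_on (- {0}) \<A>" and e: "e \<noteq> {}"
    and eig: "pseudo_diff_op \<A> (Psi0 e j a) = (\<lambda>x. c * Psi0 e j a x)"
    and \<xi>0: "\<xi>0 \<in> vball (- wave_freq e j) (- j)"
  shows "\<A> \<xi>0 = c"
proof -
  let ?S = "vball (- wave_freq e j) (- j)" and ?F = "fourier2 (Psi0 e j a)"
  define b where "b = 2 powi (- j) *s a"
  define D where "D = wave_coeff e j a * of_real ((2 powi j) ^ CARD('n)) * chi2 (dot2 (wave_freq e j) b)"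
  have D: "D \<noteq> 0" "\<And>\<xi>. ?F \<xi> = D * (chi2 (dot2 b \<xi>) * indicator ?S \<xi>)"
    by (simp_all add: fourier2_Psi0 D_def b_def)
  have S: "?S \<subseteq> - {0}" using zero_notin_freq_vball[OF e] by blast
  \<comment> \<open>Integrability is what permits splitting the inverse transform of
    \<open>G\<close> into a difference. The symbol qualifies because the ball avoids 0, so the
    symbol is continuous on it.\<close>
  have int: "integrable haar2_vec (\<lambda>\<xi>. B \<xi> * ?F \<xi>)" if "continuous_on ?S B" for B
  proof -
    have "locally_constant_on UNIV (\<lambda>\<xi>. chi2 (dot2 b \<xi>))"
      by (rule locally_constant_on_UNIV_I) (metis chi2_dot2_locally_constant)
    then have "continuous_on ?S (\<lambda>\<xi>. chi2 (dot2 b \<xi>))"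
      using locally_constant_on_imp_continuous_on continuous_on_subset by blast
    then have "integrable haar2_vec (\<lambda>\<xi>. indicator ?S \<xi> *\<^sub>R (B \<xi> * (D * chi2 (dot2 b \<xi>))))"
      using that by (intro integrable_continuous_vball continuous_intros)
    moreover have "(\<lambda>\<xi>. indicator ?S \<xi> *\<^sub>R (B \<xi> * (D * chi2 (dot2 b \<xi>)))) = (\<lambda>\<xi>. B \<xi> * ?F \<xi>)"
      by (auto simp: D(2) indicator_def)
    ultimately show ?thesis by simp
  qed
  have intA: "integrable haar2_vec (\<lambda>\<xi>. \<A> \<xi> * ?F \<xi>)"
    using locally_constant_on_imp_continuous_on[OF lc] S by (intro int) (rule continuous_on_subset)
  have intc: "integrable haar2_vec (\<lambda>\<xi>. c * ?F \<xi>)" by (intro int continuous_intros)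
  define G where "G \<xi> = \<A> \<xi> * ?F \<xi> - c * ?F \<xi>" for \<xi>
  have "inv_fourier2 G x = 0" for x
  proof -
    have "inv_fourier2 G x = inv_fourier2 (\<lambda>\<xi>. \<A> \<xi> * ?F \<xi>) x - inv_fourier2 (\<lambda>\<xi>. c * ?F \<xi>) x"
      unfolding inv_fourier2_def G_def right_diff_distrib
      by (rule Bochner_Integration.integral_diff[OF integrable_chi2_mult[OF intA] integrable_chi2_mult[OF intc]])
    also have "\<dots> = 0"
      using eig unfolding pseudo_diff_op_Psi0[OF e] inv_fourier2_fourier2_Psi0 by simp
    finally show ?thesis .
  qed
  moreover have "integrable haar2_vec G"
    unfolding G_def using intA intc by (rule Bochner_Integration.integrable_diff)
  moreover have "\<xi> \<notin> ?S \<Longrightarrow> G \<xi> = 0" for \<xi> by (simp add: G_def D(2))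
  \<comment> \<open>One radius has to keep the small ball inside the frequency ball and make both
    the symbol and the character constant on it.\<close>
  moreover have "\<exists>k\<le>- j. \<forall>\<xi>\<in>vball \<xi>0 k. G \<xi> = G \<xi>0"
  proof -
    obtain U where U: "open U" "\<xi>0 \<in> U" "\<A> constant_on (U \<inter> - {0})"
      using lc \<xi>0 S unfolding locally_constant_on_def by blast
    obtain m where m: "m \<le> - j" "vball \<xi>0 m \<subseteq> U" by (rule open_vball_subset[OF U(1,2)])
    obtain k where k: "k \<le> m" "\<And>x y. y \<in> vball x k \<Longrightarrow> chi2 (dot2 b y) = chi2 (dot2 b x)"
      by (rule chi2_dot2_locally_constant) blast
    have "G \<xi> = G \<xi>0" if \<xi>: "\<xi> \<in> vball \<xi>0 k" for \<xi>
    proof -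
      have "\<xi> \<in> ?S" using \<xi> vball_mono[of k "- j" \<xi>0] k(1) m(1) vball_eq[OF \<xi>0] by auto
      moreover have "\<xi> \<in> U" using \<xi> vball_mono[OF k(1), of \<xi>0] m(2) by blast
      moreover from calculation have "\<A> \<xi> = \<A> \<xi>0"
        using U \<xi>0 S unfolding constant_on_def by (metis IntI subsetD)
      ultimately show ?thesis using k(2)[OF \<xi>] \<xi>0 by (simp add: G_def D(2))
    qed
    moreover have "k \<le> - j" using k(1) m(1) by simp
    ultimately show ?thesis by blast
  qed
  ultimately have "G \<xi>0 = 0" using inv_fourier2_eq_0_imp[of G _ "- j" \<xi>0] \<xi>0 by blast
  then show ?thesis using D(1) \<xi>0 by (simp add: G_def D(2))
qed

text \<open>Multiplication by 2^j shrinks the unit ball to radius 2^(-j), so the affine substitution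
  carries the integral vectors \<open>\<eta>\<close> onto the frequency ball.\<close>

lemma freq_vball_conv:
  "(\<forall>\<eta>. (\<forall>\<nu>. \<eta> $ \<nu> \<in> Z2) \<longrightarrow> Q (2 powi j *s (- (inverse 2 *s kvec e) + \<eta>))) \<longleftrightarrow>
    (\<forall>\<xi>\<in>vball (- wave_freq e j) (- j). Q \<xi>)"
proof -
  have h: "2 powi (j - 1) = (inverse 2 * 2 powi j :: q2)"
    by (simp add: power_int_diff inverse_eq_divide)
  have eq: "2 powi j *s (- (inverse 2 *s kvec e) + \<eta>) = - wave_freq e j + 2 powi j *s \<eta>" for \<eta>
    by (simp add: wave_freq_def h vec_eq_iff algebra_simps)
  have mem: "- wave_freq e j + 2 powi j *s \<eta> \<in> vball (- wave_freq e j) (- j) \<longleftrightarrow> (\<forall>\<nu>. \<eta> $ \<nu> \<in> Z2)" for \<eta>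
    by (simp add: vball_def Z2_def norm2_mult norm2_2_powi power_int_minus field_simps)
  have inv: "- wave_freq e j + 2 powi j *s (2 powi (- j) *s (\<xi> + wave_freq e j)) = \<xi>" for \<xi>
    by (simp add: vec_eq_iff power_int_minus)
  show ?thesis unfolding eq using mem inv by metis
qed

theorem theorem6p1:
  fixes \<A> :: "q2 ^ 'n::finite \<Rightarrow> complex" and e :: "'n set" and j :: int and a :: "q2 ^ 'n"
  assumes "locally_constant_on (- {0}) \<A>"
    and "e \<noteq> {}"
    and "\<forall>\<nu>. a $ \<nu> \<in> dyadic_fracs"
  shows "(eigenfunction_on lizorkin (pseudo_diff_op \<A>) (Psi0 e j a) \<longleftrightarrow>
           (\<forall>\<eta>. (\<forall>\<nu>. \<eta> $ \<nu> \<in> Z2) \<longrightarrow>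
              \<A> (2 powi j *s (- (inverse 2 *s kvec e) + \<eta>)) = \<A> (- (2 powi (j - 1) *s kvec e))))
       \<and> (eigenfunction_on lizorkin (pseudo_diff_op \<A>) (Psi0 e j a) \<longrightarrow>
           pseudo_diff_op \<A> (Psi0 e j a) = (\<lambda>x. \<A> (- (2 powi (j - 1) *s kvec e)) * Psi0 e j a x))"
proof -
  let ?S = "vball (- wave_freq e j) (- j)" and ?T = "pseudo_diff_op \<A>" and ?\<Psi> = "Psi0 e j a"
  define l where "l = \<A> (- wave_freq e j)"
  \<comment> \<open>The centre is itself a point where the symbol equals the eigenvalue, which
    identifies the unknown eigenvalue with \<open>l\<close>.\<close>
  have const: "\<A> \<xi> = l" if "eigenfunction_on lizorkin ?T ?\<Psi>" "\<xi> \<in> ?S" for \<xi>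
    using that eigenfunction_Psi0_imp_constant[OF assms(1,2)] vball_self
    unfolding eigenfunction_on_def l_def by metis
  have eigenvalue: "?T ?\<Psi> = (\<lambda>x. l * ?\<Psi> x)" if "\<forall>\<xi>\<in>?S. \<A> \<xi> = l"
  proof -
    have "(\<lambda>\<xi>. \<A> \<xi> * fourier2 ?\<Psi> \<xi>) = (\<lambda>\<xi>. l * fourier2 ?\<Psi> \<xi>)"
      using that by (auto simp: fourier2_Psi0 indicator_def)
    then have "?T ?\<Psi> = inv_fourier2 (\<lambda>\<xi>. l * fourier2 ?\<Psi> \<xi>)"
      by (simp only: pseudo_diff_op_Psi0[OF assms(2)])
    then show ?thesis by (simp add: fun_eq_iff inv_fourier2_fourier2_Psi0)
  qed
  \<comment> \<open>The wavelet is nonzero at the centre of its ball, so being an eigenfunction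
    reduces to the eigenvalue equation.\<close>
  have "?\<Psi> (2 powi (- j) *s a) \<noteq> 0" by (simp add: Psi0_eq)
  then have "eigenfunction_on lizorkin ?T ?\<Psi> \<longleftrightarrow> (\<exists>c. ?T ?\<Psi> = (\<lambda>x. c * ?\<Psi> x))"
    using Psi0_lizorkin[OF assms(2)] unfolding eigenfunction_on_def by metis
  then have "eigenfunction_on lizorkin ?T ?\<Psi> \<longleftrightarrow> (\<forall>\<xi>\<in>?S. \<A> \<xi> = l)"
    using const eigenvalue by blast
  then show ?thesis
    using eigenvalue freq_vball_conv[where Q = "\<lambda>\<xi>. \<A> \<xi> = l", of j e]
    unfolding wave_freq_def[symmetric] l_def[symmetric] by blast
qed

end
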